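(* Let $\mathbb{F}$ be a field, let $C_1$ and $C_2$ be finite-dimensional $\mathbb{Z}$-graded, $\mathbb{Z}$-filtered chain complexes of vector spaces over $\mathbb{F}$, and let $X$ denote either one of the filtered complexes $V^{\mathbb{F}}=H_*(S^1;\mathbb{F})$ or $W^{\mathbb{F}}=H_*(S^0;\mathbb{F})$, each supported in filtration level $0$. If $C_1\otimes_{\mathbb{F}}X$ is filtered chain homotopy equivalent to $C_2\otimes_{\mathbb{F}}X$, then $C_1$ is filtered chain homotopy equivalent to $C_2$.
   Context: $V^{\mathbb{F}}=H_*(S^1;\mathbb{F})$ and $W^{\mathbb{F}}=H_*(S^0;\mathbb{F})$ are graded complexes with zero differential: $V^{\mathbb{F}}$ has one generator in degree $1$ and one in degree $0$, and $W^{\mathbb{F}}=\mathbb{F}^2$ lies in degree $0$. Both are made into $\mathbb{Z}$-filtered complexes by declaring each to be supported in filtration level $0$. A $\mathbb{Z}$-graded, $\mathbb{Z}$-filtered chain complex is a graded vector space $C=\bigoplus_iC_i$ with an increasing filtration $\cdots\subseteq F_kC\subseteq F_{k+1}C\subseteq\cdots$ with $\bigcup_kF_kC=C$, $\bigcap_kF_kC=0$, and a differential $\partial$ with $\partial^2=0$ and $\partial(F_kC_i)\subseteq F_kC_{i-1}$. Tensor products carry the tensor product grading and filtration. A filtered chain homotopy equivalence consists of (degree-preserving) filtered chain maps in both directions whose composites are homotopic to the identities through filtered chain homotopies. *)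

theory Defs
  imports Complex_Main "HOL-Library.Function_Algebras" "HOL-Library.Product_Plus"
begin

section \<open>Filtered chain complexes\<close>

text \<open>A complex lives on a subspace \<open>carr C\<close> of an ambient vector space, namely the whole type
  \<open>'a\<close> with scalar multiplication \<open>scl C\<close>. Only the values of \<open>dif C\<close> on \<open>carr C\<close> matter.\<close>

record ('k, 'a) filt_complex =
  scl :: "'k \<Rightarrow> 'a \<Rightarrow> 'a"
  carr :: "'a set"
  grd :: "int \<Rightarrow> 'a set"
  fil :: "int \<Rightarrow> 'a set"
  dif :: "'a \<Rightarrow> 'a"

definition linear_on ::
    "'a::plus set \<Rightarrow> ('k \<Rightarrow> 'a \<Rightarrow> 'a) \<Rightarrow> ('k \<Rightarrow> 'b::plus \<Rightarrow> 'b) \<Rightarrow> ('a \<Rightarrow> 'b) \<Rightarrow> bool" where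
  "linear_on S s1 s2 f \<longleftrightarrow>
     (\<forall>x\<in>S. \<forall>y\<in>S. f (x + y) = f x + f y) \<and> (\<forall>c. \<forall>x\<in>S. f (s1 c x) = s2 c (f x))"

definition internal_direct_sum :: "('i \<Rightarrow> 'a::comm_monoid_add set) \<Rightarrow> 'a set \<Rightarrow> bool" where
  "internal_direct_sum G S \<longleftrightarrow>
     (\<forall>f. (\<forall>i. f i \<in> G i) \<and> finite {i. f i \<noteq> 0} \<longrightarrow> (\<Sum>i | f i \<noteq> 0. f i) \<in> S) \<and>
     (\<forall>x\<in>S. \<exists>!f. (\<forall>i. f i \<in> G i) \<and> finite {i. f i \<noteq> 0} \<and> x = (\<Sum>i | f i \<noteq> 0. f i))"

text \<open>The part \<open>F\<^sub>k C\<^sub>i\<close> of degree \<open>i\<close> and filtration level \<open>k\<close> is \<open>fil C k \<inter> grd C i\<close>; the filtration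
  is by graded subspaces.\<close>

locale filtered_complex = vector_space "scl C"
  for C :: "('k::field, 'a::ab_group_add) filt_complex" +
  assumes subspace_carr: "subspace (carr C)"
    and subspace_grd: "subspace (grd C i)"
    and grd_direct_sum: "internal_direct_sum (grd C) (carr C)"
    and subspace_fil: "subspace (fil C k)"
    and fil_graded: "internal_direct_sum (\<lambda>i. fil C k \<inter> grd C i) (fil C k)"
    and fil_Suc: "fil C k \<subseteq> fil C (k + 1)"
    and fil_Union: "(\<Union>k. fil C k) = carr C"
    and fil_Inter: "(\<Inter>k. fil C k) = {0}"
    and dif_linear: "linear_on (carr C) (scl C) (scl C) (dif C)"
    and dif_dif: "x \<in> carr C \<Longrightarrow> dif C (dif C x) = 0"
    and dif_fil_grd: "dif C ` (fil C k \<inter> grd C i) \<subseteq> fil C k \<inter> grd C (i - 1)"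

definition fin_dim :: "('k::field, 'a::ab_group_add) filt_complex \<Rightarrow> bool" where
  "fin_dim C \<longleftrightarrow> (\<exists>B. finite B \<and> module.span (scl C) B = carr C)"


section \<open>Filtered chain homotopy equivalence\<close>

definition filtered_chain_map ::
    "('k::field, 'a::ab_group_add) filt_complex \<Rightarrow> ('k, 'b::ab_group_add) filt_complex
      \<Rightarrow> ('a \<Rightarrow> 'b) \<Rightarrow> bool" where
  "filtered_chain_map C D f \<longleftrightarrow>
     linear_on (carr C) (scl C) (scl D) f \<and>
     (\<forall>i. f ` grd C i \<subseteq> grd D i) \<and>
     (\<forall>k. f ` fil C k \<subseteq> fil D k) \<and>
     (\<forall>x\<in>carr C. f (dif C x) = dif D (f x))"

definition filtered_homotopic ::
    "('k::field, 'a::ab_group_add) filt_complex \<Rightarrow> ('k, 'b::ab_group_add) filt_complex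
      \<Rightarrow> ('a \<Rightarrow> 'b) \<Rightarrow> ('a \<Rightarrow> 'b) \<Rightarrow> bool" where
  "filtered_homotopic C D f g \<longleftrightarrow>
     (\<exists>h. linear_on (carr C) (scl C) (scl D) h \<and>
          (\<forall>i. h ` grd C i \<subseteq> grd D (i + 1)) \<and>
          (\<forall>k. h ` fil C k \<subseteq> fil D k) \<and>
          (\<forall>x\<in>carr C. f x - g x = dif D (h x) + h (dif C x)))"

definition filtered_homotopy_equivalent ::
    "('k::field, 'a::ab_group_add) filt_complex \<Rightarrow> ('k, 'b::ab_group_add) filt_complex \<Rightarrow> bool" where
  "filtered_homotopy_equivalent C D \<longleftrightarrow>
     (\<exists>f g. filtered_chain_map C D f \<and> filtered_chain_map D C g \<and>
            filtered_homotopic C C (g \<circ> f) id \<and> filtered_homotopic D D (f \<circ> g) id)"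


section \<open>Tensor products\<close>

text \<open>The tensor product is realised as the span of the evaluation functionals
  \<open>x \<otimes> y = (\<beta> \<mapsto> \<beta> x y)\<close> on bilinear forms; its universal property is proved below.\<close>

definition bilinear_on ::
    "('k::field, 'a::ab_group_add) filt_complex \<Rightarrow> ('k, 'b::ab_group_add) filt_complex
      \<Rightarrow> ('k \<Rightarrow> 'z::plus \<Rightarrow> 'z) \<Rightarrow> ('a \<Rightarrow> 'b \<Rightarrow> 'z) \<Rightarrow> bool" where
  "bilinear_on C D s \<beta> \<longleftrightarrow>
     (\<forall>y\<in>carr D. linear_on (carr C) (scl C) s (\<lambda>x. \<beta> x y)) \<and>
     (\<forall>x\<in>carr C. linear_on (carr D) (scl D) s (\<beta> x))"

definition pure_tensor ::
    "('k::field, 'a::ab_group_add) filt_complex \<Rightarrow> ('k, 'b::ab_group_add) filt_complex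
      \<Rightarrow> 'a \<Rightarrow> 'b \<Rightarrow> (('a \<Rightarrow> 'b \<Rightarrow> 'k) \<Rightarrow> 'k)" where
  "pure_tensor C D x y = (\<lambda>\<beta>. if bilinear_on C D (*) \<beta> then \<beta> x y else 0)"

definition tensor_scl :: "'k::field \<Rightarrow> ('c \<Rightarrow> 'k) \<Rightarrow> ('c \<Rightarrow> 'k)" where
  "tensor_scl c t = (\<lambda>\<beta>. c * t \<beta>)"

definition tensor_carr ::
    "('k::field, 'a::ab_group_add) filt_complex \<Rightarrow> ('k, 'b::ab_group_add) filt_complex
      \<Rightarrow> (('a \<Rightarrow> 'b \<Rightarrow> 'k) \<Rightarrow> 'k) set" where
  "tensor_carr C D =
     module.span tensor_scl {pure_tensor C D x y | x y. x \<in> carr C \<and> y \<in> carr D}"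

text \<open>The defining condition determines the differential on \<open>tensor_carr C D\<close>, see
  \<open>tensor_dif_props\<close> and \<open>tensor_dif_unique\<close> below.\<close>

definition is_tensor_dif ::
    "('k::field, 'a::ab_group_add) filt_complex \<Rightarrow> ('k, 'b::ab_group_add) filt_complex
      \<Rightarrow> ((('a \<Rightarrow> 'b \<Rightarrow> 'k) \<Rightarrow> 'k) \<Rightarrow> (('a \<Rightarrow> 'b \<Rightarrow> 'k) \<Rightarrow> 'k)) \<Rightarrow> bool" where
  "is_tensor_dif C D d \<longleftrightarrow>
     linear_on (tensor_carr C D) tensor_scl tensor_scl d \<and>
     (\<forall>i. \<forall>x\<in>grd C i. \<forall>y\<in>carr D.
        d (pure_tensor C D x y) =
          pure_tensor C D (dif C x) y + tensor_scl ((-1) powi i) (pure_tensor C D x (dif D y)))"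

definition tensor ::
    "('k::field, 'a::ab_group_add) filt_complex \<Rightarrow> ('k, 'b::ab_group_add) filt_complex
      \<Rightarrow> ('k, ('a \<Rightarrow> 'b \<Rightarrow> 'k) \<Rightarrow> 'k) filt_complex" where
  "tensor C D =
     \<lparr>scl = tensor_scl,
      carr = tensor_carr C D,
      grd = (\<lambda>n. module.span tensor_scl
               {pure_tensor C D x y | x y i j. i + j = n \<and> x \<in> grd C i \<and> y \<in> grd D j}),
      fil = (\<lambda>n. module.span tensor_scl
               {pure_tensor C D x y | x y p q. p + q = n \<and> x \<in> fil C p \<and> y \<in> fil D q}),
      dif = (SOME d. is_tensor_dif C D d)\<rparr>"


section \<open>The homology of the circle and of the two-point space\<close>

text \<open>\<open>H_S1\<close> has basis \<open>(1, 0)\<close> in degree 1 and \<open>(0, 1)\<close> in degree 0.\<close>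

definition H_S1 :: "('k::field, 'k \<times> 'k) filt_complex" where
  "H_S1 =
     \<lparr>scl = (\<lambda>c (a, b). (c * a, c * b)),
      carr = UNIV,
      grd = (\<lambda>i. if i = 1 then range (\<lambda>a. (a, 0)) else if i = 0 then range (\<lambda>b. (0, b)) else {0}),
      fil = (\<lambda>k. if k < 0 then {0} else UNIV),
      dif = (\<lambda>_. 0)\<rparr>"

definition H_S0 :: "('k::field, 'k \<times> 'k) filt_complex" where
  "H_S0 =
     \<lparr>scl = (\<lambda>c (a, b). (c * a, c * b)),
      carr = UNIV,
      grd = (\<lambda>i. if i = 0 then UNIV else {0}),
      fil = (\<lambda>k. if k < 0 then {0} else UNIV),
      dif = (\<lambda>_. 0)\<rparr>"


section \<open>Basic facts\<close>

lemma vector_space_tensor_scl: "vector_space (tensor_scl :: 'k::field \<Rightarrow> ('c \<Rightarrow> 'k) \<Rightarrow> _)"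
  by unfold_locales (auto simp: tensor_scl_def fun_eq_iff algebra_simps)

interpretation tensor_space: vector_space "tensor_scl :: 'k::field \<Rightarrow> ('c \<Rightarrow> 'k) \<Rightarrow> ('c \<Rightarrow> 'k)"
  by (rule vector_space_tensor_scl)

lemma bilinear_pure_tensor: "bilinear_on C D tensor_scl (pure_tensor C D)"
  unfolding bilinear_on_def pure_tensor_def linear_on_def tensor_scl_def
  by (auto simp: fun_eq_iff)

lemma pure_tensor_in_tensor_carr:
  "x \<in> carr C \<Longrightarrow> y \<in> carr D \<Longrightarrow> pure_tensor C D x y \<in> tensor_carr C D"
  unfolding tensor_carr_def by (rule tensor_space.span_base) blast

lemma linear_on_tensor_carr_eq:
  assumes "vector_space s" and f: "linear_on (tensor_carr C D) tensor_scl s f"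
    and g: "linear_on (tensor_carr C D) tensor_scl s g"
    and eq: "\<And>x y. x \<in> carr C \<Longrightarrow> y \<in> carr D \<Longrightarrow> f (pure_tensor C D x y) = g (pure_tensor C D x y)"
    and t: "t \<in> tensor_carr C D"
  shows "f t = g t"
proof -
  interpret vector_space s by fact
  have 0: "0 \<in> tensor_carr C D"
    unfolding tensor_carr_def by (rule tensor_space.span_zero)
  have z: "f 0 = 0" "g 0 = 0"
    using f g 0 unfolding linear_on_def by (metis scale_zero_left tensor_space.scale_zero_left)+
  have "t \<in> tensor_carr C D \<and> f t = g t"
    using t[unfolded tensor_carr_def]
  proof (induction rule: tensor_space.span_induct_alt)
    case base
    show ?case using 0 z by (simp del: zero_fun_apply)
  next
    case (step c x y)
    then obtain a b where ab: "a \<in> carr C" "b \<in> carr D" "x = pure_tensor C D a b" by blast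
    have x: "x \<in> tensor_carr C D" using ab pure_tensor_in_tensor_carr by blast
    then have cx: "tensor_scl c x \<in> tensor_carr C D"
      unfolding tensor_carr_def by (rule tensor_space.span_scale)
    then have "tensor_scl c x + y \<in> tensor_carr C D"
      using step unfolding tensor_carr_def by (blast intro: tensor_space.span_add)
    then show ?case
      using f g step(2) eq[OF ab(1,2)] x cx unfolding linear_on_def ab(3) by metis
  qed
  then show ?thesis by simp
qed

lemma functional_separates:
  fixes s :: "'k::field \<Rightarrow> 'z::ab_group_add \<Rightarrow> 'z"
  assumes "vector_space s" and "z \<noteq> 0"
  shows "\<exists>\<phi>. Vector_Spaces.linear s (*) \<phi> \<and> \<phi> z = (1::'k)"
proof -
  interpret vs: vector_space s by fact
  interpret kk: vector_space "(*) :: 'k \<Rightarrow> 'k \<Rightarrow> 'k"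
    by unfold_locales (auto simp: algebra_simps)
  interpret vector_space_pair s "(*) :: 'k \<Rightarrow> 'k \<Rightarrow> 'k" ..
  have "vs.independent {z}" using assms(2) by simp
  from linear_independent_extend[OF this, of "\<lambda>_. 1"] show ?thesis by auto
qed

lemma tensor_universal:
  fixes C :: "('k::field, 'a::ab_group_add) filt_complex"
    and D :: "('k, 'b::ab_group_add) filt_complex"
    and s :: "'k \<Rightarrow> 'z::ab_group_add \<Rightarrow> 'z"
  assumes "vector_space s" and f: "bilinear_on C D s f"
  shows "\<exists>g. linear_on (tensor_carr C D) tensor_scl s g \<and>
             (\<forall>x\<in>carr C. \<forall>y\<in>carr D. g (pure_tensor C D x y) = f x y)"
proof -
  interpret vs: vector_space s by fact
  define P where "P t z \<longleftrightarrow>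
    (\<forall>\<phi>. Vector_Spaces.linear s ((*) :: 'k \<Rightarrow> _) \<phi> \<longrightarrow> \<phi> z = t (\<lambda>x y. \<phi> (f x y)))" for t z
  have P_pure: "P (pure_tensor C D x y) (f x y)" for x y
    unfolding P_def
  proof (intro allI impI)
    fix \<phi> assume "Vector_Spaces.linear s ((*) :: 'k \<Rightarrow> _) \<phi>"
    then interpret Vector_Spaces.linear s "(*) :: 'k \<Rightarrow> 'k \<Rightarrow> 'k" \<phi> .
    have "bilinear_on C D (*) (\<lambda>x y. \<phi> (f x y))"
      using f unfolding bilinear_on_def linear_on_def by (simp add: add scale)
    then show "\<phi> (f x y) = pure_tensor C D x y (\<lambda>x y. \<phi> (f x y))"
      by (simp add: pure_tensor_def)
  qed
  have P_0: "P 0 0"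
    unfolding P_def
    by (auto dest: Vector_Spaces.linear.axioms module_hom.zero simp: module_hom_iff_linear[symmetric])
  have P_add: "P (t + t') (z + z')" if "P t z" "P t' z'" for t t' z z'
    using that unfolding P_def
    by (auto simp: module_hom_iff_linear[symmetric] module_hom.add)
  have P_scl: "P (tensor_scl c t) (s c z)" if "P t z" for c t z
    using that unfolding P_def
    by (auto simp: module_hom_iff_linear[symmetric] module_hom.scale tensor_scl_def)
  have P_unique: "z = z'" if "P t z" "P t z'" for t z z'
  proof (rule ccontr)
    assume "z \<noteq> z'"
    then obtain \<phi> where \<phi>: "Vector_Spaces.linear s ((*) :: 'k \<Rightarrow> _) \<phi>" "\<phi> (z - z') = 1"
      using functional_separates[OF assms(1), of "z - z'"] by auto
    have "\<phi> (z - z') = \<phi> z - \<phi> z'"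
      using \<phi>(1) by (simp add: module_hom_iff_linear[symmetric] module_hom.diff)
    then show False using that \<phi> unfolding P_def by auto
  qed
  have P_ex: "\<exists>z. P t z" if "t \<in> tensor_carr C D" for t
    using that[unfolded tensor_carr_def]
  proof (induction rule: tensor_space.span_induct_alt)
    case base
    then show ?case using P_0 by blast
  next
    case (step c x y)
    then show ?case using P_pure P_add P_scl by blast
  qed
  define g where "g t = (THE z. P t z)" for t
  have g: "g t = z" if "P t z" for t z
    unfolding g_def using that P_unique by blast
  have "linear_on (tensor_carr C D) tensor_scl s g"
    unfolding linear_on_def by (metis P_ex P_add P_scl g)
  then show ?thesis using g P_pure by blast
qed

lemma (in filtered_complex) grd_subset: "grd C i \<subseteq> carr C"
proof
  fix x assume x: "x \<in> grd C i"
  define f where "f j = (if j = i then x else 0)" for j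
  have "\<forall>j. f j \<in> grd C j"
    using x subspace_0[OF subspace_grd] by (simp add: f_def)
  moreover have sub: "{j. f j \<noteq> 0} \<subseteq> {i}" by (auto simp: f_def)
  then have "finite {j. f j \<noteq> 0}" by (rule finite_subset) simp
  moreover have "(\<Sum>j | f j \<noteq> 0. f j) = (\<Sum>j\<in>{i}. f j)"
    by (rule sum.mono_neutral_left) (use sub in auto)
  then have "(\<Sum>j | f j \<noteq> 0. f j) = x" by (simp add: f_def)
  ultimately show "x \<in> carr C"
    using grd_direct_sum unfolding internal_direct_sum_def by metis
qed

lemma (in filtered_complex) dif_carr:
  assumes "x \<in> carr C"
  shows "dif C x \<in> carr C"
proof -
  from grd_direct_sum assms obtain f where f: "\<forall>i. f i \<in> grd C i" "finite {i. f i \<noteq> 0}"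
    "x = (\<Sum>i | f i \<noteq> 0. f i)"
    unfolding internal_direct_sum_def by blast
  have fc: "f i \<in> carr C" for i using f grd_subset by blast
  have d: "dif C (f i) \<in> carr C" for i
  proof -
    obtain k where "f i \<in> fil C k" using fil_Union fc by blast
    then show ?thesis using dif_fil_grd[of k i] f fil_Union by blast
  qed
  have 0: "dif C 0 = 0"
    using dif_linear subspace_0[OF subspace_carr] unfolding linear_on_def
    by (metis scale_zero_left)
  have "(\<Sum>i\<in>A. f i) \<in> carr C \<and> dif C (\<Sum>i\<in>A. f i) \<in> carr C" if "finite A" for A
    using that
  proof (induction rule: finite_induct)
    case empty
    then show ?case using 0 subspace_0[OF subspace_carr] by simp
  next
    case (insert i A)
    then show ?case
      using dif_linear fc d subspace_add[OF subspace_carr] unfolding linear_on_def by simp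
  qed
  then show ?thesis using f by blast
qed

lemma (in filtered_complex) ex_sign_involution:
  "\<exists>e. linear_on (carr C) (scl C) (scl C) e \<and> (\<forall>x\<in>carr C. e x \<in> carr C) \<and>
       (\<forall>i. \<forall>x\<in>grd C i. e x = scl C ((-1) powi i) x)"
proof -
  define Q where "Q x f \<longleftrightarrow> (\<forall>i. f i \<in> grd C i) \<and> finite {i. f i \<noteq> 0} \<and>
    x = (\<Sum>i | f i \<noteq> 0. f i)" for x f
  have Q_alt: "Q x f \<longleftrightarrow> (\<forall>i. f i \<in> grd C i) \<and> (\<exists>A. finite A \<and> (\<forall>i. i \<notin> A \<longrightarrow> f i = 0) \<and>
    x = (\<Sum>i\<in>A. f i))" for x f
  proof
    assume "Q x f"
    then show "(\<forall>i. f i \<in> grd C i) \<and> (\<exists>A. finite A \<and> (\<forall>i. i \<notin> A \<longrightarrow> f i = 0) \<and> x = (\<Sum>i\<in>A. f i))"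
      unfolding Q_def by (auto intro!: exI[of _ "{i. f i \<noteq> 0}"])
  next
    assume a: "(\<forall>i. f i \<in> grd C i) \<and> (\<exists>A. finite A \<and> (\<forall>i. i \<notin> A \<longrightarrow> f i = 0) \<and> x = (\<Sum>i\<in>A. f i))"
    then obtain A where A: "finite A" "\<forall>i. i \<notin> A \<longrightarrow> f i = 0" "x = (\<Sum>i\<in>A. f i)" by blast
    then have sub: "{i. f i \<noteq> 0} \<subseteq> A" by auto
    then have "(\<Sum>i | f i \<noteq> 0. f i) = (\<Sum>i\<in>A. f i)"
      using A by (intro sum.mono_neutral_left) auto
    then show "Q x f" using a A sub finite_subset unfolding Q_def by auto
  qed
  have Q_ex: "\<exists>!f. Q x f" if "x \<in> carr C" for x
    using grd_direct_sum that unfolding internal_direct_sum_def Q_def by blast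
  have Q_add: "Q (x + y) (\<lambda>i. f i + g i)" if fg: "Q x f" "Q y g" for x y f g
  proof -
    from fg obtain A B where A: "finite A" "\<forall>i. i \<notin> A \<longrightarrow> f i = 0" "x = (\<Sum>i\<in>A. f i)"
      and B: "finite B" "\<forall>i. i \<notin> B \<longrightarrow> g i = 0" "y = (\<Sum>i\<in>B. g i)"
      unfolding Q_alt by blast
    have "(\<Sum>i\<in>A. f i) = (\<Sum>i\<in>A\<union>B. f i)" "(\<Sum>i\<in>B. g i) = (\<Sum>i\<in>A\<union>B. g i)"
      using A B by (auto intro!: sum.mono_neutral_left)
    then have "x + y = (\<Sum>i\<in>A\<union>B. f i + g i)"
      using A B by (simp add: sum.distrib)
    moreover have "\<forall>i. f i + g i \<in> grd C i"
      using fg subspace_add[OF subspace_grd] unfolding Q_def by blast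
    moreover have "\<forall>i. i \<notin> A \<union> B \<longrightarrow> f i + g i = 0" using A B by simp
    ultimately show ?thesis unfolding Q_alt using A B by blast
  qed
  have Q_scl: "Q (scl C c x) (\<lambda>i. scl C c (f i))" if f: "Q x f" for x c f
  proof -
    from f obtain A where A: "finite A" "\<forall>i. i \<notin> A \<longrightarrow> f i = 0" "x = (\<Sum>i\<in>A. f i)"
      unfolding Q_alt by blast
    have "scl C c x = (\<Sum>i\<in>A. scl C c (f i))" using A by (simp add: scale_sum_right)
    moreover have "\<forall>i. scl C c (f i) \<in> grd C i"
      using f subspace_scale[OF subspace_grd] unfolding Q_def by blast
    moreover have "\<forall>i. i \<notin> A \<longrightarrow> scl C c (f i) = 0" using A by simp
    ultimately show ?thesis unfolding Q_alt using A by blast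
  qed
  define cmp where "cmp x = (THE f. Q x f)" for x
  have cmp: "cmp x = f" if "Q x f" "x \<in> carr C" for x f
    unfolding cmp_def using that Q_ex by blast
  have cmpQ: "Q x (cmp x)" if "x \<in> carr C" for x
    unfolding cmp_def using theI'[OF Q_ex[OF that]] .
  define e where "e x = (\<Sum>i | cmp x i \<noteq> 0. scl C ((-1) powi i) (cmp x i))" for x
  have e: "e x = (\<Sum>i\<in>A. scl C ((-1) powi i) (cmp x i))"
    if "finite A" "{i. cmp x i \<noteq> 0} \<subseteq> A" for x A
    unfolding e_def using that by (intro sum.mono_neutral_left) auto
  have fin: "finite {i. cmp x i \<noteq> 0}" if "x \<in> carr C" for x
    using cmpQ[OF that] unfolding Q_def by blast
  have "e (x + y) = e x + e y" if xy: "x \<in> carr C" "y \<in> carr C" for x y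
  proof -
    let ?A = "{i. cmp x i \<noteq> 0} \<union> {i. cmp y i \<noteq> 0}"
    have c: "cmp (x + y) = (\<lambda>i. cmp x i + cmp y i)"
      using xy by (intro cmp Q_add cmpQ subspace_add[OF subspace_carr])
    have "e (x + y) = (\<Sum>i\<in>?A. scl C ((-1) powi i) (cmp (x + y) i))"
      using fin xy by (intro e) (auto simp: c)
    also have "\<dots> = e x + e y"
      using fin xy by (simp add: e[of ?A x] e[of ?A y] c scale_right_distrib sum.distrib)
    finally show ?thesis .
  qed
  moreover have "e (scl C c x) = scl C c (e x)" if x: "x \<in> carr C" for c x
  proof -
    let ?A = "{i. cmp x i \<noteq> 0}"
    have c: "cmp (scl C c x) = (\<lambda>i. scl C c (cmp x i))"
      using x by (intro cmp Q_scl cmpQ subspace_scale[OF subspace_carr])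
    have "e (scl C c x) = (\<Sum>i\<in>?A. scl C ((-1) powi i) (cmp (scl C c x) i))"
      using fin x by (intro e) (auto simp: c)
    also have "\<dots> = scl C c (e x)"
      by (simp add: e_def c scale_sum_right mult.commute)
    finally show ?thesis .
  qed
  moreover have "e x \<in> carr C" if "x \<in> carr C" for x
  proof -
    have "cmp x i \<in> carr C" for i
      using cmpQ[OF that] grd_subset unfolding Q_def by blast
    then show ?thesis
      unfolding e_def by (intro subspace_sum[OF subspace_carr] subspace_scale[OF subspace_carr])
  qed
  moreover have "e x = scl C ((-1) powi i) x" if x: "x \<in> grd C i" for i x
  proof -
    have "Q x (\<lambda>j. if j = i then x else 0)"
      unfolding Q_alt using x subspace_0[OF subspace_grd] by (auto intro!: exI[of _ "{i}"])
    then have "cmp x = (\<lambda>j. if j = i then x else 0)"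
      using x grd_subset by (intro cmp) auto
    then show ?thesis using e[of "{i}" x] by (simp add: Collect_conv_if)
  qed
  ultimately show ?thesis unfolding linear_on_def by blast
qed

lemma ex_tensor_dif:
  assumes "filtered_complex C" and "filtered_complex D"
  shows "\<exists>d. is_tensor_dif C D d"
proof -
  interpret C: filtered_complex C by fact
  interpret D: filtered_complex D by fact
  obtain e where e: "linear_on (carr C) (scl C) (scl C) e" "\<forall>x\<in>carr C. e x \<in> carr C"
      "\<forall>i. \<forall>x\<in>grd C i. e x = scl C ((-1) powi i) x"
    using C.ex_sign_involution by blast
  let ?p = "pure_tensor C D"
  note bl = bilinear_pure_tensor[of C D, unfolded bilinear_on_def linear_on_def]
  have "bilinear_on C D tensor_scl (\<lambda>x y. ?p (dif C x) y + ?p (e x) (dif D y))"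
    unfolding bilinear_on_def linear_on_def
    using bl C.dif_linear[unfolded linear_on_def] D.dif_linear[unfolded linear_on_def]
      e(1)[unfolded linear_on_def] e(2) C.dif_carr D.dif_carr
    by (simp add: tensor_space.scale_right_distrib add_ac)
  from tensor_universal[OF vector_space_tensor_scl this] obtain d
    where d: "linear_on (tensor_carr C D) tensor_scl tensor_scl d"
      "\<forall>x\<in>carr C. \<forall>y\<in>carr D. d (?p x y) = ?p (dif C x) y + ?p (e x) (dif D y)" by blast
  have "is_tensor_dif C D d"
    unfolding is_tensor_dif_def using d e(3) bl C.grd_subset D.dif_carr
    by (metis subsetD)
  then show ?thesis by blast
qed

lemma tensor_dif_props:
  assumes "filtered_complex C" and "filtered_complex D"
  shows "is_tensor_dif C D (dif (tensor C D))"
  using someI_ex[OF ex_tensor_dif[OF assms]] by (simp add: tensor_def)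

lemma tensor_dif_unique:
  assumes "filtered_complex C" and d: "is_tensor_dif C D d" "is_tensor_dif C D d'"
    and t: "t \<in> tensor_carr C D"
  shows "d t = d' t"
proof (rule linear_on_tensor_carr_eq[OF vector_space_tensor_scl _ _ _ t])
  interpret C: filtered_complex C by fact
  show l: "linear_on (tensor_carr C D) tensor_scl tensor_scl d"
    "linear_on (tensor_carr C D) tensor_scl tensor_scl d'"
    using d unfolding is_tensor_dif_def by blast+
  fix x y assume x: "x \<in> carr C" and y: "y \<in> carr D"
  note bl = bilinear_pure_tensor[of C D, unfolded bilinear_on_def linear_on_def]
  from C.grd_direct_sum x obtain f where f: "\<forall>i. f i \<in> grd C i" "finite {i. f i \<noteq> 0}"
    "x = (\<Sum>i | f i \<noteq> 0. f i)"
    unfolding internal_direct_sum_def by blast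
  have fc: "f i \<in> carr C" for i using f C.grd_subset by blast
  have p0: "pure_tensor C D 0 y = 0"
    using bl y C.subspace_0[OF C.subspace_carr]
    by (metis C.scale_zero_left tensor_space.scale_zero_left)
  have "0 \<in> tensor_carr C D"
    unfolding tensor_carr_def by (rule tensor_space.span_zero)
  then have 0: "d 0 = 0" "d' 0 = 0"
    using l unfolding linear_on_def by (metis tensor_space.scale_zero_left)+
  have "(\<Sum>i\<in>A. f i) \<in> carr C \<and>
      d (pure_tensor C D (\<Sum>i\<in>A. f i) y) = d' (pure_tensor C D (\<Sum>i\<in>A. f i) y)"
    if "finite A" for A
    using that
  proof (induction rule: finite_induct)
    case empty
    show ?case using p0 0 C.subspace_0[OF C.subspace_carr] by (simp del: zero_fun_apply)
  next
    case (insert i A)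
    have "d (pure_tensor C D (f i) y) = d' (pure_tensor C D (f i) y)"
      using d f(1) y unfolding is_tensor_dif_def by metis
    moreover have "f i + (\<Sum>i\<in>A. f i) \<in> carr C"
      using insert fc C.subspace_add[OF C.subspace_carr] by blast
    moreover have "pure_tensor C D (f i + (\<Sum>i\<in>A. f i)) y
        = pure_tensor C D (f i) y + pure_tensor C D (\<Sum>i\<in>A. f i) y"
      using bl insert fc y by blast
    ultimately show ?case
      using insert(1,2,3) l pure_tensor_in_tensor_carr[OF fc y, of i]
        pure_tensor_in_tensor_carr[of "\<Sum>i\<in>A. f i" C y D, OF _ y]
      unfolding linear_on_def by (simp del: plus_fun_apply)
  qed
  then show "d (pure_tensor C D x y) = d' (pure_tensor C D x y)"
    using f by blast
qed

lemma internal_direct_sumI: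
  assumes S: "\<And>f. (\<And>i. f i \<in> G i) \<Longrightarrow> f (0::int) + f 1 \<in> S"
    and 0: "\<And>i. i \<noteq> 0 \<Longrightarrow> i \<noteq> 1 \<Longrightarrow> G i = {0}"
    and ex: "\<And>x. x \<in> S \<Longrightarrow> \<exists>u v. u \<in> G 0 \<and> v \<in> G 1 \<and> x = u + v"
    and uq: "\<And>u v u' v'. u \<in> G 0 \<Longrightarrow> v \<in> G 1 \<Longrightarrow> u' \<in> G 0 \<Longrightarrow> v' \<in> G 1 \<Longrightarrow>
               u + v = u' + v' \<Longrightarrow> u = u' \<and> v = v'"
  shows "internal_direct_sum G S"
proof -
  have sum: "finite {i. f i \<noteq> 0} \<and> (\<Sum>i | f i \<noteq> 0. f i) = f 0 + f 1" if "\<And>i. f i \<in> G i" for f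
  proof -
    have "f i = 0" if "i \<noteq> 0" "i \<noteq> 1" for i
      using that 0 \<open>\<And>i. f i \<in> G i\<close> by (metis singletonD)
    then have sub: "{i. f i \<noteq> 0} \<subseteq> {0, 1}" by blast
    then have "(\<Sum>i | f i \<noteq> 0. f i) = (\<Sum>i\<in>{0, 1}. f i)"
      by (intro sum.mono_neutral_left) auto
    then show ?thesis using finite_subset[OF sub] by simp
  qed
  show ?thesis
    unfolding internal_direct_sum_def
  proof (intro conjI allI impI ballI)
    fix f assume "(\<forall>i. f i \<in> G i) \<and> finite {i. f i \<noteq> 0}"
    then show "(\<Sum>i | f i \<noteq> 0. f i) \<in> S" using sum S by metis
  next
    fix x assume "x \<in> S"
    then obtain u v where uv: "u \<in> G 0" "v \<in> G 1" "x = u + v" using ex by blast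
    let ?f = "\<lambda>i::int. if i = 0 then u else if i = 1 then v else 0"
    have G: "?f i \<in> G i" for i using uv 0 by auto
    show "\<exists>!f. (\<forall>i. f i \<in> G i) \<and> finite {i. f i \<noteq> 0} \<and> x = (\<Sum>i | f i \<noteq> 0. f i)"
    proof (rule ex1I[of _ ?f])
      show "(\<forall>i. ?f i \<in> G i) \<and> finite {i. ?f i \<noteq> 0} \<and> x = (\<Sum>i | ?f i \<noteq> 0. ?f i)"
        using sum[of ?f, OF G] G uv(3) by auto
    next
      fix g assume g: "(\<forall>i. g i \<in> G i) \<and> finite {i. g i \<noteq> 0} \<and> x = (\<Sum>i | g i \<noteq> 0. g i)"
      then have "g 0 + g 1 = u + v" using sum[of g] uv by simp
      then have "g 0 = u \<and> g 1 = v" using g uv uq by blast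
      moreover have "g i = 0" if "i \<noteq> 0" "i \<noteq> 1" for i
        using that 0 g by (metis singletonD)
      ultimately show "g = ?f" by auto
    qed
  qed
qed

lemma vector_space_pair_scl:
  "vector_space (\<lambda>(c::'k::field) (a, b). (c * a, c * b))"
  by unfold_locales (auto simp: algebra_simps)

lemma filtered_complex_H_S1: "filtered_complex (H_S1 :: ('k::field, _) filt_complex)"
proof -
  interpret vector_space "\<lambda>(c::'k) (a, b). (c * a, c * b)" by (rule vector_space_pair_scl)
  have fil: "fil H_S1 (-1) = {0 :: 'k \<times> 'k}" "0 \<in> fil H_S1 k" for k :: int
    by (auto simp: H_S1_def zero_prod_def)
  then have "(\<Inter>k. fil H_S1 k) = {0 :: 'k \<times> 'k}" by blast
  then show ?thesis
    by unfold_locales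
      (auto simp: H_S1_def subspace_def linear_on_def zero_prod_def algebra_simps
        split: if_splits intro!: internal_direct_sumI exI[of _ "0::int"])
qed

lemma filtered_complex_H_S0: "filtered_complex (H_S0 :: ('k::field, _) filt_complex)"
proof -
  interpret vector_space "\<lambda>(c::'k) (a, b). (c * a, c * b)" by (rule vector_space_pair_scl)
  have fil: "fil H_S0 (-1) = {0 :: 'k \<times> 'k}" "0 \<in> fil H_S0 k" for k :: int
    by (auto simp: H_S0_def zero_prod_def)
  then have "(\<Inter>k. fil H_S0 k) = {0 :: 'k \<times> 'k}" by blast
  then show ?thesis
    by unfold_locales
      (auto simp: H_S0_def subspace_def linear_on_def zero_prod_def algebra_simps
        split: if_splits intro!: internal_direct_sumI exI[of _ "0::int"])
qed

end

theory Submission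
  imports Defs
begin

text \<open>
  The idea is to classify finite-dimensional filtered complexes over a field by their barcodes. Such a
  complex has a homogeneous basis, adapted to the filtration, in which the differential maps every basis
  vector to zero or to another basis vector, and never two of them to the same one (\<open>ex_barcode_basis\<close>).
  The complex is thus a sum of bars: single cycles, and pairs \<open>c \<mapsto> b\<close> in which \<open>b\<close> is born at its own
  level and dies at the level of \<open>c\<close>. Pairs of equal levels are contractible by a filtered homotopy, so up
  to filtered homotopy equivalence the complex is determined by the number of the other bars of each
  degree, birth and death (\<open>homotopy_equivalent_if_same_survivors\<close>).

  Conversely these numbers are invariants. For \<open>q \<le> p\<close>, the number of bars in degree \<open>i\<close> born by level \<open>q\<close>
  and alive at level \<open>p\<close> is the rank of the map from the degree \<open>i\<close> homology of \<open>F\<^sub>q C\<close> to that of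
  \<open>F\<^sub>p C\<close>, which cannot change under an equivalence (\<open>survivors_card_le\<close>); numbers of bars are
  differences of such ranks (\<open>card_bars_eq\<close>).

  Tensoring with the homology of the circle or of two points gives \<open>C[s] \<oplus> C\<close>, with \<open>s = 1\<close> or \<open>s = 0\<close>
  (\<open>tensor_plane\<close>), and this turns the counts \<open>n i\<close> in degree \<open>i\<close> into \<open>n (i - s) + n i\<close>. As the counts vanish
  in low degrees, they can be recovered from these sums (\<open>shift_sum_cancel\<close>). So equivalent tensor
  products come from complexes with equal counts, which are equivalent.\<close>

section \<open>Linear algebra on subspaces\<close>

lemma (in vector_space) span_Int_independent:
  assumes "independent B" "S \<subseteq> B" "T \<subseteq> B" and S: "x \<in> span S" and T: "x \<in> span T"
  shows "x \<in> span (S \<inter> T)"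
proof -
  have "representation S x = representation T x"
    using assms by (metis representation_extend)
  then have "{b. representation S x b \<noteq> 0} \<subseteq> S \<inter> T"
    using representation_ne_zero by fastforce
  moreover have "x \<in> span {b. representation S x b \<noteq> 0}"
  proof -
    have "(\<Sum>b | representation S x b \<noteq> 0. representation S x b *s b) = x"
      using assms independent_mono by (intro sum_nonzero_representation_eq) blast+
    moreover have "(\<Sum>b | representation S x b \<noteq> 0. representation S x b *s b)
        \<in> span {b. representation S x b \<noteq> 0}"
      by (intro span_sum span_scale span_base)
    ultimately show ?thesis by simp
  qed
  ultimately show ?thesis using span_mono by blast
qed

text \<open>A linear map that kills \<open>Z\<close> and sends \<open>N\<close> bijectively to an independent set is injective on the span
  of \<open>N\<close>, so the \<open>N\<close>-part of a kernel element vanishes. Both a differential that permutes basis vectors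
  and a coordinate projection have this form.\<close>

lemma (in vector_space_pair) kernel_in_span:
  assumes f: "Vector_Spaces.linear s1 s2 f" and Z: "\<And>z. z \<in> Z \<Longrightarrow> f z = 0"
    and N: "vs2.independent (f ` N)" "inj_on f N"
    and y: "y \<in> vs1.span (Z \<union> N)" "f y = 0"
  shows "y \<in> vs1.span Z"
proof -
  obtain z n where zn: "z \<in> vs1.span Z" "n \<in> vs1.span N" "y = z + n"
    using y(1) unfolding vs1.span_Un by blast
  have "f z = 0" using linear_eq_0_on_span[OF f Z zn(1)] .
  then have "f n = 0" using y(2) zn(3) linear_add[OF f] by simp
  moreover have "inj_on f (vs1.span N)"
    using linear_inj_on_span_independent_image[OF f N] .
  ultimately have "n = 0"
    using linear_inj_on_iff_eq_0[OF f vs1.subspace_span] zn(2) by blast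
  then show ?thesis using zn by simp
qed

lemma (in vector_space_pair) linear_image_span_subset:
  assumes "Vector_Spaces.linear s1 s2 f" "vs2.subspace U" "f ` B \<subseteq> U"
  shows "f ` vs1.span B \<subseteq> U"
  using assms linear_span_image vs2.span_minimal by metis

text \<open>The maps between complexes are linear only on a carrier. Extending them to the ambient space makes
  the theory of linear maps applicable to them.\<close>

lemma (in vector_space_pair) linear_on_extend:
  assumes S: "vs1.subspace S" and f: "linear_on S s1 s2 f"
  shows "\<exists>g. Vector_Spaces.linear s1 s2 g \<and> (\<forall>x\<in>S. g x = f x)"
proof -
  obtain B where B: "B \<subseteq> S" "vs1.independent B" "S \<subseteq> vs1.span B"
    using vs1.maximal_independent_subset by blast
  obtain g where g: "Vector_Spaces.linear s1 s2 g" "\<forall>x\<in>B. g x = f x"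
    using linear_independent_extend[OF B(2)] by blast
  have f0: "f 0 = 0"
    using f vs1.subspace_0[OF S] unfolding linear_on_def
    by (metis vs1.scale_zero_left vs2.scale_zero_left)
  have "x \<in> S \<and> g x = f x" if "x \<in> vs1.span B" for x
    using that
  proof (induction rule: vs1.span_induct_alt)
    case base
    show ?case using f0 vs1.subspace_0[OF S] linear_0[OF g(1)] by simp
  next
    case (step c x y)
    moreover have "s1 c x \<in> S" "x \<in> S" using step B(1) vs1.subspace_scale[OF S] by blast+
    ultimately show ?case
      using f g(2) linear_add[OF g(1)] linear_scale[OF g(1)] vs1.subspace_add[OF S]
      unfolding linear_on_def by simp
  qed
  then show ?thesis using g(1) B(3) by blast
qed

lemma linear_on_diff:
  assumes "vector_space s1" "vector_space s2" "module.subspace s1 S" "linear_on S s1 s2 f"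
    "x \<in> S" "y \<in> S"
  shows "f (x - y) = f x - f y"
proof -
  interpret vector_space_pair s1 s2 using assms by (simp add: vector_space_pair_def)
  obtain g where g: "Vector_Spaces.linear s1 s2 g" "\<forall>x\<in>S. g x = f x"
    using linear_on_extend[OF assms(3,4)] by blast
  show ?thesis using g assms(5,6) linear_diff[OF g(1)] vs1.subspace_diff[OF assms(3)] by metis
qed

lemma linear_on_zero:
  assumes "vector_space s1" "vector_space s2" "0 \<in> S" "linear_on S s1 s2 f"
  shows "f 0 = 0"
  using assms unfolding linear_on_def
  by (metis vector_space.vector_space_assms(4) module.scale_zero_left module_iff_vector_space)

section \<open>Homogeneous elements\<close>

context filtered_complex
begin

lemma dif_zero: "dif C 0 = 0"
  by (rule linear_on_zero[OF _ _ _ dif_linear])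
     (use vector_space_axioms subspace_0[OF subspace_carr] in auto)

lemma fil_mono: "j \<le> k \<Longrightarrow> fil C j \<subseteq> fil C k"
proof (induction k rule: int_ge_induct)
  case base
  then show ?case by simp
next
  case (step k)
  then show ?case using fil_Suc by blast
qed

lemma fil_subset: "fil C k \<subseteq> carr C"
  using fil_Union by blast

lemma linear_extension_dif:
  obtains D where "Vector_Spaces.linear (scl C) (scl C) D" "\<And>x. x \<in> carr C \<Longrightarrow> D x = dif C x"
proof -
  interpret vector_space_pair "scl C" "scl C" ..
  show ?thesis using linear_on_extend[OF subspace_carr dif_linear] that by blast
qed

lemma grd_component_unique:
  assumes f: "\<And>j. f j \<in> grd C j" "finite A" "\<And>j. j \<notin> A \<Longrightarrow> f j = 0" and z: "sum f A \<in> grd C i"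
  shows "f i = sum f A"
proof -
  define Q where "Q g \<longleftrightarrow> (\<forall>j. g j \<in> grd C j) \<and> finite {j. g j \<noteq> 0} \<and>
    sum f A = (\<Sum>j | g j \<noteq> 0. g j)" for g
  have QI: "Q g" if g: "\<And>j. g j \<in> grd C j" "finite S" "\<And>j. j \<notin> S \<Longrightarrow> g j = 0" "sum f A = sum g S"
    for g S
  proof -
    have sub: "{j. g j \<noteq> 0} \<subseteq> S" using g(3) by blast
    have "sum g S = (\<Sum>j | g j \<noteq> 0. g j)"
      by (rule sum.mono_neutral_right) (use sub g(2) in auto)
    then show ?thesis using g finite_subset[OF sub] unfolding Q_def by simp
  qed
  let ?\<delta> = "\<lambda>j. if j = i then sum f A else 0"
  have "sum f A \<in> carr C" using z grd_subset by blast
  then have "\<exists>!g. Q g" using grd_direct_sum unfolding internal_direct_sum_def Q_def by simp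
  moreover have "Q f" by (rule QI[OF f refl])
  moreover have "Q ?\<delta>"
    by (rule QI[of _ "{i}"]) (use z subspace_0[OF subspace_grd] in auto)
  ultimately have "f = ?\<delta>" by (elim ex1E) blast
  from fun_cong[OF this, of i] show ?thesis by simp
qed

lemma degree_unique:
  assumes "x \<in> grd C i" "x \<in> grd C j" "x \<noteq> 0"
  shows "i = j"
proof -
  have "(if m = j then x else 0) \<in> grd C m" for m
    using assms(2) subspace_0[OF subspace_grd] by simp
  from grd_component_unique[of "\<lambda>m. if m = j then x else 0" "{j}" i, OF this] assms
  show ?thesis by (auto split: if_splits)
qed

text \<open>A combination of homogeneous vectors groups into homogeneous components; when the result is itself
  homogeneous, uniqueness of components leaves only the group of its own degree.\<close>

lemma homogeneous_in_span:
  assumes B: "\<And>b. b \<in> B \<Longrightarrow> \<exists>i. b \<in> grd C i" and z: "z \<in> span B" "z \<in> grd C i"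
  shows "z \<in> span (B \<inter> grd C i)"
proof -
  have "\<exists>f A. finite A \<and> (\<forall>j. f j \<in> span (B \<inter> grd C j)) \<and> (\<forall>j. j \<notin> A \<longrightarrow> f j = 0) \<and> z = sum f A"
    using z(1)
  proof (induction rule: span_induct_alt)
    case base
    show ?case by (rule exI[of _ "\<lambda>_. 0"], rule exI[of _ "{}"]) (simp add: span_zero)
  next
    case (step c b y)
    then obtain f A where f: "finite A" "\<forall>j. f j \<in> span (B \<inter> grd C j)" "\<forall>j. j \<notin> A \<longrightarrow> f j = 0"
      "y = sum f A" by blast
    obtain m where m: "b \<in> grd C m" using B step by blast
    let ?g = "\<lambda>j. (if j = m then scl C c b else 0) + f j"
    have "sum ?g (insert m A) = scl C c b + sum f (insert m A)"
      using f(1) by (simp add: sum.distrib)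
    moreover have "sum f (insert m A) = sum f A"
      by (rule sum.mono_neutral_right) (use f in auto)
    ultimately have "scl C c b + y = sum ?g (insert m A)" using f(4) by simp
    moreover have "?g j \<in> span (B \<inter> grd C j)" for j
    proof (rule span_add)
      have "scl C c b \<in> span (B \<inter> grd C m)" using m step(1) by (simp add: span_base span_scale)
      then show "(if j = m then scl C c b else 0) \<in> span (B \<inter> grd C j)" by (simp add: span_zero)
    qed (use f(2) in blast)
    ultimately show ?case
      using f(1,3) by (intro exI[of _ ?g], intro exI[of _ "insert m A"]) simp
  qed
  then obtain f A where f: "finite A" "\<And>j. f j \<in> span (B \<inter> grd C j)" "\<And>j. j \<notin> A \<Longrightarrow> f j = 0"
    "z = sum f A" by blast
  have "f j \<in> grd C j" for j
    using f(2) span_minimal[OF _ subspace_grd] by blast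
  then have "f i = z" using grd_component_unique[of f A i] f(1,3,4) z(2) by simp
  then show ?thesis using f(2) by blast
qed

text \<open>The filtration steps are graded, so if all homogeneous components of a vector lay in \<open>U\<close>, the vector
  would too.\<close>

lemma homogeneous_outside:
  assumes U: "subspace U" and k: "\<not> fil C k \<subseteq> U"
  obtains x i where "x \<in> fil C k" "x \<in> grd C i" "x \<notin> U"
proof -
  obtain y where y: "y \<in> fil C k" "y \<notin> U" using k by blast
  obtain f where f: "\<forall>i. f i \<in> fil C k \<inter> grd C i" "y = (\<Sum>i | f i \<noteq> 0. f i)"
    using fil_graded[of k] y(1) unfolding internal_direct_sum_def by blast
  have "\<exists>i. f i \<notin> U" using f(2) y(2) subspace_sum[OF U, of "{i. f i \<noteq> 0}" f] by metis
  then show ?thesis using f(1) that by blast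
qed

lemma level_exists:
  assumes "x \<in> carr C" "x \<noteq> 0"
  shows "\<exists>l. x \<in> fil C l \<and> x \<notin> fil C (l - 1)"
proof -
  obtain m where m: "x \<notin> fil C m" using assms(2) fil_Inter by blast
  obtain p where p: "x \<in> fil C p" using assms(1) fil_Union by blast
  have "m \<le> p" using m p fil_mono[of p m] by (meson in_mono linear)
  then have "x \<in> fil C p \<Longrightarrow> ?thesis"
  proof (induction p rule: int_ge_induct)
    case base
    then show ?case using m by blast
  next
    case (step q)
    then show ?case by (cases "x \<in> fil C q") auto
  qed
  then show ?thesis using p by blast
qed

text \<open>A decreasing chain of subspaces of a finite-dimensional space is eventually constant, and the
  constant value is the intersection \<open>0\<close>. Dimension is measured here by the size of a basis of
  \<open>fil C k\<close>: a step \<open>k1\<close> of smallest dimension is contained in all others.\<close>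

lemma fil_trivial:
  assumes "fin_dim C"
  shows "\<exists>k. fil C k = {0}"
proof -
  obtain B0 where B0: "finite B0" "span B0 = carr C"
    using assms unfolding fin_dim_def by blast
  define P where "P k B \<longleftrightarrow> B \<subseteq> fil C k \<and> independent B \<and> fil C k \<subseteq> span B" for k B
  have P_ex: "\<exists>B. P k B" for k unfolding P_def by (metis maximal_independent_subset)
  have P_fin: "finite B" if "P k B" for k B
    using that independent_span_bound[OF B0(1)] B0(2) fil_subset unfolding P_def by blast
  obtain B1 where "\<exists>k. P k B1" and least: "\<And>k B. P k B \<Longrightarrow> card B1 \<le> card B"
    using ex_has_least_nat[of "\<lambda>B. \<exists>k. P k B" "SOME B. P 0 B" card] someI_ex[OF P_ex[of 0]] by blast
  then obtain k1 where B1: "P k1 B1" by blast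
  have "fil C k1 \<subseteq> fil C k" for k
  proof (cases "k1 \<le> k")
    case True
    then show ?thesis by (rule fil_mono)
  next
    case False
    then have sub: "fil C k \<subseteq> fil C k1" using fil_mono by simp
    obtain B where B: "P k B" using P_ex by blast
    have "x \<in> span B" if x: "x \<in> fil C k1" for x
    proof (rule ccontr)
      assume nx: "x \<notin> span B"
      have "independent (insert x B)" using nx B unfolding P_def by (simp add: independent_insertI)
      moreover have "insert x B \<subseteq> span B1" using x B B1 sub unfolding P_def by blast
      ultimately have "card (insert x B) \<le> card B1"
        using independent_span_bound[OF P_fin[OF B1]] by blast
      moreover have "card (insert x B) = Suc (card B)"
        using nx P_fin[OF B] span_base by (intro card_insert_disjoint) auto
      ultimately show False using least[OF B] by simp
    qed
    moreover have "span B = fil C k"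
      using B subspace_fil unfolding P_def by (simp add: span_subspace)
    ultimately show ?thesis by blast
  qed
  then have "fil C k1 = {0}" using fil_Inter subspace_0[OF subspace_fil] by blast
  then show ?thesis by blast
qed

end

section \<open>Existence of barcode bases\<close>

text \<open>A barcode basis splits the complex into bars: pairs \<open>c \<mapsto> b = dif C c\<close> and single cycles. Degrees and
  levels of basis vectors are not recorded but read off from membership in \<open>grd C i\<close> and \<open>fil C k\<close>,
  and the basis is adapted to the grading and the filtration in the sense that it contains a basis of each
  \<open>grd C i\<close> and \<open>fil C k\<close>. The axioms can be checked for a sum of two complexes summand by summand.\<close>

locale barcode_basis = vector_space "scl C"
  for C :: "('k::field, 'a::ab_group_add) filt_complex" and B :: "'a set" +
  assumes finite_basis: "finite B"
    and independent_basis: "independent B"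
    and carr_eq: "carr C = span B"
    and basis_homogeneous: "b \<in> B \<Longrightarrow> \<exists>i. b \<in> grd C i"
    and grd_eq: "grd C i = span (B \<inter> grd C i)"
    and fil_eq: "fil C k = span (B \<inter> fil C k)"
    and fil_mono: "j \<le> k \<Longrightarrow> fil C j \<subseteq> fil C k"
    and dif_linear: "linear_on (carr C) (scl C) (scl C) (dif C)"
    and dif_basis: "b \<in> B \<Longrightarrow> dif C b \<in> insert 0 B"
    and dif_inj: "inj_on (dif C) {b \<in> B. dif C b \<noteq> 0}"

context filtered_complex
begin

text \<open>A barcode basis of a subcomplex in the making. Adaptedness to the grading follows from homogeneity
  (\<open>homogeneous_in_span\<close>), whereas adaptedness to the filtration has to be carried along: a combination of basis vectors
  can a priori have a lower level than its terms.\<close>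

definition partial_barcode_basis :: "'a set \<Rightarrow> bool" where
  "partial_barcode_basis B \<longleftrightarrow>
     finite B \<and> independent B \<and> B \<subseteq> carr C \<and> (\<forall>b\<in>B. \<exists>i. b \<in> grd C i) \<and>
     (\<forall>k. span B \<inter> fil C k \<subseteq> span (B \<inter> fil C k)) \<and>
     (\<forall>b\<in>B. dif C b \<in> insert 0 B) \<and> inj_on (dif C) {b \<in> B. dif C b \<noteq> 0}"

lemma barcode_basis_if_spanning:
  assumes B: "partial_barcode_basis B" and sp: "span B = carr C"
  shows "barcode_basis C B"
proof
  show "grd C i = span (B \<inter> grd C i)" for i
  proof
    show "grd C i \<subseteq> span (B \<inter> grd C i)"
      using homogeneous_in_span[of B] B sp grd_subset unfolding partial_barcode_basis_def by blast
    show "span (B \<inter> grd C i) \<subseteq> grd C i" by (simp add: span_minimal subspace_grd)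
  qed
  show "fil C k = span (B \<inter> fil C k)" for k
  proof
    show "fil C k \<subseteq> span (B \<inter> fil C k)"
      using B sp fil_subset unfolding partial_barcode_basis_def by blast
    show "span (B \<inter> fil C k) \<subseteq> fil C k" by (simp add: span_minimal subspace_fil)
  qed
qed (use B sp fil_mono dif_linear in \<open>auto simp: partial_barcode_basis_def\<close>)

text \<open>Since \<open>span B\<close> already contains everything of level below \<open>k\<close>, a combination that involves the new
  vector \<open>x\<close> has level at least \<open>k\<close>, so \<open>x\<close> cannot destroy adaptedness to the filtration.\<close>

lemma partial_barcode_basis_insert:
  assumes B: "partial_barcode_basis B" and x: "x \<in> fil C k" "x \<in> grd C i" "x \<notin> span B"
    and below: "fil C (k - 1) \<subseteq> span B"
    and dx: "dif C x = 0 \<or> (dif C x \<in> B \<and> dif C x \<notin> dif C ` B)"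
  shows "partial_barcode_basis (insert x B)"
  unfolding partial_barcode_basis_def
proof (intro conjI allI ballI subsetI)
  note B' = B[unfolded partial_barcode_basis_def]
  show "finite (insert x B)" "independent (insert x B)"
    using B' x(3) by (auto simp: independent_insertI)
  show "y \<in> carr C" if "y \<in> insert x B" for y using that B' x(2) grd_subset by blast
  show "\<exists>i. b \<in> grd C i" if "b \<in> insert x B" for b using that B' x(2) by blast
  show "dif C b \<in> insert 0 (insert x B)" if "b \<in> insert x B" for b using that B' dx by blast
  have "inj_on (dif C) {b \<in> B. dif C b \<noteq> 0}" using B' by blast
  moreover have "dif C x \<noteq> dif C b" if "b \<in> B" "dif C b \<noteq> 0" for b using dx that by auto
  ultimately show "inj_on (dif C) {b \<in> insert x B. dif C b \<noteq> 0}"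
    unfolding inj_on_def by (metis (mono_tags, lifting) insert_iff mem_Collect_eq)
  show "y \<in> span (insert x B \<inter> fil C l)" if y: "y \<in> span (insert x B) \<inter> fil C l" for y l
  proof -
    obtain c where c: "y - scl C c x \<in> span B" using y span_breakdown_eq by blast
    show ?thesis
    proof (cases "k \<le> l")
      case True
      then have xl: "x \<in> fil C l" using x(1) fil_mono by blast
      then have "y - scl C c x \<in> fil C l"
        using y by (auto intro!: subspace_diff subspace_scale subspace_fil)
      then have "y - scl C c x \<in> span (B \<inter> fil C l)" using c B' by blast
      then show ?thesis using span_breakdown_eq[of y x "B \<inter> fil C l"] xl by auto
    next
      case False
      then have "fil C l \<subseteq> span B" using below fil_mono[of l "k - 1"] by simp
      then have "y \<in> span (B \<inter> fil C l)" using y B' by blast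
      then show ?thesis using span_mono[of "B \<inter> fil C l" "insert x B \<inter> fil C l"] by blast
    qed
  qed
qed

text \<open>A combination \<open>u\<close> of unpaired cycles can replace one of them. The cycle to be dropped must have
  the highest level among those that occur in \<open>u\<close>: then it is recovered from \<open>u\<close> and vectors of no
  higher level, so each filtration step keeps its span. Nothing else is disturbed because an unpaired
  cycle is not the boundary of a basis vector.\<close>

lemma partial_barcode_basis_exchange:
  assumes B: "partial_barcode_basis B"
    and U: "\<And>b. b \<in> U \<Longrightarrow> b \<in> B \<and> b \<in> grd C i \<and> dif C b = 0 \<and> b \<notin> dif C ` B"
    and u: "u \<in> span U" "u \<noteq> 0"
  obtains b0 where "b0 \<in> U" "u \<notin> span (B - {b0})" "span (insert u (B - {b0})) = span B"
    "partial_barcode_basis (insert u (B - {b0}))" "dif C u = 0"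
proof -
  note B' = B[unfolded partial_barcode_basis_def]
  have UB: "U \<subseteq> B" using U by blast
  have ind: "independent B" "independent U" using B' UB independent_mono by blast+
  have finU: "finite U" using UB B' finite_subset by blast
  have uB: "u \<in> span B" using u(1) span_mono[OF UB] by blast
  have u_grd: "u \<in> grd C i"
    using u(1) U span_minimal[of U "grd C i"] subspace_grd by blast
  have u_carr: "u \<in> carr C" using u_grd grd_subset by blast
  have du: "dif C u = 0"
  proof -
    obtain D where D: "Vector_Spaces.linear (scl C) (scl C) D" "\<And>x. x \<in> carr C \<Longrightarrow> D x = dif C x"
      using linear_extension_dif by blast
    interpret vector_space_pair "scl C" "scl C" ..
    have "D b = 0" if "b \<in> U" for b using D(2) U[OF that] B' by auto
    then have "D u = 0" by (rule linear_eq_0_on_span[OF D(1) _ u(1)])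
    then show ?thesis using D(2) u_carr by simp
  qed
  obtain l where l: "u \<in> fil C l" "u \<notin> fil C (l - 1)"
    using level_exists[OF u_carr u(2)] by blast
  let ?R = "\<lambda>b. representation B u b"
  define S where "S = {b. ?R b \<noteq> 0}"
  have "u \<in> span (B \<inter> fil C l)" using uB l(1) B' by blast
  then have "u \<in> span (U \<inter> (B \<inter> fil C l))" by (rule span_Int_independent[OF ind(1) UB _ u(1), rotated]) auto
  then have "?R = representation (U \<inter> (B \<inter> fil C l)) u"
    using representation_extend[OF ind(1)] UB by blast
  then have S_sub: "S \<subseteq> U \<inter> fil C l" unfolding S_def using representation_ne_zero by fastforce
  then have finS: "finite S" using finU finite_subset by blast
  have u_sum: "u = (\<Sum>b\<in>S. scl C (?R b) b)"
    unfolding S_def using sum_nonzero_representation_eq[OF ind(1) uB] by simp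
  have "\<not> S \<subseteq> fil C (l - 1)"
  proof
    assume "S \<subseteq> fil C (l - 1)"
    then have "(\<Sum>b\<in>S. scl C (?R b) b) \<in> fil C (l - 1)"
      by (intro subspace_sum subspace_scale subspace_fil) blast
    then show False using l(2) u_sum by simp
  qed
  \<comment> \<open>All terms of \<open>u\<close> have level at most \<open>l\<close>, and \<open>b0\<close> attains it.\<close>
  then obtain b0 where b0: "b0 \<in> S" "b0 \<notin> fil C (l - 1)" by blast
  have b0U: "b0 \<in> U" "b0 \<in> B" using b0 S_sub UB by auto
  have Rb0: "?R b0 \<noteq> 0" using b0 by (simp add: S_def)
  have u_not: "u \<notin> span (B - {b0})"
  proof
    assume "u \<in> span (B - {b0})"
    then have "?R = representation (B - {b0}) u"
      by (intro representation_extend[OF ind(1)]) auto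
    then have "b0 \<in> B - {b0}" using Rb0 representation_ne_zero by metis
    then show False by simp
  qed
  have b0_in: "b0 \<in> span (insert u (S - {b0}))"
  proof -
    define v where "v = (\<Sum>b\<in>S - {b0}. scl C (?R b) b)"
    have "v \<in> span (insert u (S - {b0}))"
      unfolding v_def by (intro span_sum span_scale span_base) simp
    moreover have "u \<in> span (insert u (S - {b0}))" by (simp add: span_base)
    moreover have "u - v = scl C (?R b0) b0"
      unfolding diff_eq_eq v_def
      by (rule trans[OF u_sum]) (rule sum.remove[OF finS b0(1)])
    ultimately have "scl C (inverse (?R b0)) (scl C (?R b0) b0) \<in> span (insert u (S - {b0}))"
      by (metis span_diff span_scale)
    then show ?thesis using Rb0 by simp
  qed
  let ?B = "insert u (B - {b0})"
  have b0_in': "b0 \<in> span (?B \<inter> fil C m)" if "l \<le> m" for m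
  proof -
    have "insert u (S - {b0}) \<subseteq> ?B \<inter> fil C m"
      using S_sub UB l(1) fil_mono[OF that] by blast
    then show ?thesis using b0_in span_mono by blast
  qed
  have sp: "span ?B = span B"
  proof -
    have "b0 \<in> span ?B" using b0_in' span_mono[of "?B \<inter> fil C l" ?B] by blast
    then have "B \<subseteq> span ?B" using span_superset[of ?B] by blast
    moreover have "?B \<subseteq> span B" using uB span_superset[of B] by blast
    ultimately show ?thesis by (simp add: span_eq)
  qed
  have db0: "dif C b \<noteq> b0" if "b \<in> B" for b using U[OF b0U(1)] that by blast
  have "partial_barcode_basis ?B"
    unfolding partial_barcode_basis_def
  proof (intro conjI allI ballI subsetI)
    show "finite ?B" "independent ?B"
      using B' u_not independent_mono[of B "B - {b0}"] by (auto simp: independent_insertI)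
    show "y \<in> carr C" if "y \<in> ?B" for y using that u_carr B' by blast
    show "\<exists>i. b \<in> grd C i" if "b \<in> ?B" for b using that u_grd B' by blast
    show "dif C b \<in> insert 0 ?B" if "b \<in> ?B" for b using that du db0 B' by blast
    have "{b \<in> ?B. dif C b \<noteq> 0} \<subseteq> {b \<in> B. dif C b \<noteq> 0}" using du by auto
    then show "inj_on (dif C) {b \<in> ?B. dif C b \<noteq> 0}" using B' inj_on_subset by blast
    show "y \<in> span (?B \<inter> fil C m)" if y: "y \<in> span ?B \<inter> fil C m" for y m
    proof -
      have ym: "y \<in> span (B \<inter> fil C m)" using y sp B' by blast
      have "B \<inter> fil C m \<subseteq> span (?B \<inter> fil C m)"
      proof (cases "b0 \<in> fil C m")
        case True
        then have "l \<le> m" using b0(2) fil_mono[of m "l - 1"] by fastforce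
        then have "b0 \<in> span (?B \<inter> fil C m)" by (rule b0_in')
        moreover have "B \<inter> fil C m - {b0} \<subseteq> span (?B \<inter> fil C m)"
          using span_superset[of "?B \<inter> fil C m"] by blast
        ultimately show ?thesis by blast
      next
        case False
        then show ?thesis using span_superset[of "?B \<inter> fil C m"] by blast
      qed
      then show ?thesis using ym span_minimal[OF _ subspace_span] by blast
    qed
  qed
  then show ?thesis using that b0U u_not sp du by blast
qed

text \<open>The reduction step of the persistence algorithm. Take a homogeneous \<open>x\<close> of lowest level \<open>k\<close> outside
  \<open>span B\<close> whose boundary lies in \<open>span B\<close>; the cycle \<open>dif C x\<close> is a combination of basis cycles. The part
  that involves boundaries of basis vectors is removed by subtracting a combination \<open>w\<close> of those vectors
  from \<open>x\<close>. What remains is a combination \<open>u\<close> of unpaired cycles. If \<open>u\<close> is zero, \<open>x - w\<close> is a new unpaired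
  cycle; otherwise \<open>u\<close> is exchanged for one of the cycles and paired with \<open>x - w\<close>.\<close>

lemma partial_barcode_basis_step:
  assumes B: "partial_barcode_basis B" and Bk: "B \<subseteq> fil C k" and below: "fil C (k - 1) \<subseteq> span B"
    and nk: "\<not> fil C k \<subseteq> span B"
  obtains B' where "partial_barcode_basis B'" "B' \<subseteq> fil C k" "span B \<subseteq> span B'" "card B' = Suc (card B)"
proof -
  note B' = B[unfolded partial_barcode_basis_def]
  obtain D where D: "Vector_Spaces.linear (scl C) (scl C) D" "\<And>x. x \<in> carr C \<Longrightarrow> D x = dif C x"
    using linear_extension_dif by blast
  interpret VP: vector_space_pair "scl C" "scl C" ..
  have dfg: "dif C x \<in> fil C k \<inter> grd C (i - 1)" if "x \<in> fil C k" "x \<in> grd C i" for x i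
    using that dif_fil_grd by blast
  \<comment> \<open>If the boundary of a chosen vector is outside the span, the boundary itself is a better choice.\<close>
  have "\<exists>x i. x \<in> fil C k \<and> x \<in> grd C i \<and> x \<notin> span B \<and> dif C x \<in> span B"
  proof -
    obtain x i where x: "x \<in> fil C k" "x \<in> grd C i" "x \<notin> span B"
      using homogeneous_outside[OF subspace_span nk] by blast
    have "dif C (dif C x) = 0" using x fil_subset dif_dif by blast
    then show ?thesis using x dfg[of x i] span_zero by (cases "dif C x \<in> span B") (metis IntE)+
  qed
  then obtain x i where x: "x \<in> fil C k" "x \<in> grd C i" "x \<notin> span B" "dif C x \<in> span B" by blast
  have xc: "x \<in> carr C" using x fil_subset by blast
  have dx: "dif C x \<in> fil C k" "dif C x \<in> grd C (i - 1)" using dfg x by auto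
  \<comment> \<open>\<open>U\<close> consists of the unpaired cycles, \<open>W\<close> of the basis vectors that bound the paired ones.\<close>
  define Z where "Z = {b \<in> B \<inter> grd C (i - 1). dif C b = 0}"
  define U where "U = Z - dif C ` B"
  define W where "W = {c \<in> B. dif C c \<in> Z}"
  have ZB: "Z \<subseteq> B" by (auto simp: Z_def)
  have Bc: "B \<subseteq> carr C" using B' by blast
  have WB: "W \<subseteq> B" by (auto simp: W_def)
  have W_grd: "W \<subseteq> grd C i"
  proof
    fix c assume c: "c \<in> W"
    then obtain j where j: "c \<in> grd C j" using B' by (auto simp: W_def)
    have "dif C c \<in> B" "dif C c \<in> grd C (i - 1)" using c by (auto simp: W_def Z_def)
    moreover have "dif C c \<in> grd C (j - 1)" using dif_fil_grd[of k j] j c Bk WB by blast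
    moreover have "0 \<notin> B" using B' dependent_zero by blast
    ultimately have "i - 1 = j - 1" using degree_unique by metis
    then show "c \<in> grd C i" using j by simp
  qed
  \<comment> \<open>Basis vectors that are not cycles have independent boundaries, so they do not occur in the cycle
    \<open>dif C x\<close>.\<close>
  have dxZ: "dif C x \<in> span Z"
  proof -
    let ?N = "{b \<in> B \<inter> grd C (i - 1). dif C b \<noteq> 0}"
    have Bg: "B \<inter> grd C (i - 1) = Z \<union> ?N" by (auto simp: Z_def)
    have DN: "D b = dif C b" if "b \<in> B" for b using that Bc D(2) by blast
    have "dif C ` ?N \<subseteq> B" using B' by auto
    then have "independent (D ` ?N)"
      using independent_mono[of B "D ` ?N"] B' DN by (auto simp: image_subset_iff)
    moreover have "inj_on D ?N"
    proof -
      have "inj_on (dif C) ?N" by (rule inj_on_subset[of _ "{b \<in> B. dif C b \<noteq> 0}"]) (use B' in auto)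
      then show ?thesis by (rule inj_on_cong[THEN iffD1, rotated]) (simp add: DN)
    qed
    moreover have "dif C x \<in> span (Z \<union> ?N)"
      using homogeneous_in_span[OF _ x(4) dx(2)] B' unfolding Bg[symmetric] by blast
    moreover have "D (dif C x) = 0" using D(2) dx fil_subset dif_dif xc by force
    moreover have "D z = 0" if "z \<in> Z" for z using that by (auto simp: Z_def DN)
    ultimately show ?thesis using VP.kernel_in_span[OF D(1)] by blast
  qed
  have "Z \<subseteq> U \<union> D ` W"
    using D(2) Bc ZB by (auto simp: U_def W_def image_iff Bex_def subset_iff)
  then obtain u v where uv: "u \<in> span U" "v \<in> span (D ` W)" "dif C x = u + v"
    using dxZ span_mono[of Z "U \<union> D ` W"] unfolding span_Un by blast
  obtain w where w: "w \<in> span W" "v = D w" using uv(2) VP.linear_span_image[OF D(1)] by blast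
  have w_in: "w \<in> fil C k" "w \<in> grd C i" "w \<in> span B"
    using w(1) span_minimal[of W "fil C k"] span_minimal[of W "grd C i"] subspace_fil subspace_grd
      W_grd WB Bk span_mono[of W B] by blast+
  define y where "y = x - w"
  have y: "y \<in> fil C k" "y \<in> grd C i"
    using x w_in by (auto simp: y_def intro!: subspace_diff subspace_fil subspace_grd)
  have y_not: "y \<notin> span B" using x(3) w_in(3) span_add[of y B w] by (auto simp: y_def)
  have dy: "dif C y = u"
  proof -
    have "D y = D x - D w" unfolding y_def by (rule VP.linear_diff[OF D(1)])
    moreover have "y \<in> carr C" using y(1) fil_subset by blast
    ultimately show ?thesis using uv(3) w(2) D(2) xc by simp
  qed
  have U: "\<And>b. b \<in> U \<Longrightarrow> b \<in> B \<and> b \<in> grd C (i - 1) \<and> dif C b = 0 \<and> b \<notin> dif C ` B"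
    by (auto simp: U_def Z_def)
  show ?thesis
  proof (cases "u = 0")
    case True
    show ?thesis
    proof (rule that[of "insert y B"])
      show "partial_barcode_basis (insert y B)"
        by (rule partial_barcode_basis_insert[OF B y y_not below]) (simp add: dy True)
      show "insert y B \<subseteq> fil C k" using y Bk by blast
      show "span B \<subseteq> span (insert y B)" by (intro span_mono) blast
      show "card (insert y B) = Suc (card B)" using B' y_not span_base by (intro card_insert_disjoint) auto
    qed
  next
    case False
    from partial_barcode_basis_exchange[OF B U uv(1) False]
    obtain b0 where b0: "b0 \<in> U" "u \<notin> span (B - {b0})" "span (insert u (B - {b0})) = span B"
      "partial_barcode_basis (insert u (B - {b0}))" "dif C u = 0" by blast
    let ?B = "insert u (B - {b0})"
    have uk: "u \<in> fil C k" using dy y dfg by blast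
    have fresh: "u \<notin> dif C ` ?B"
    proof
      assume "u \<in> dif C ` ?B"
      then obtain b where b: "b \<in> ?B" "dif C b = u" by blast
      then have "b \<in> B" using False b0(5) by auto
      then have "u \<in> B" using B' b(2) False by auto
      moreover have "u \<noteq> b0" using U[OF b0(1)] b(2) \<open>b \<in> B\<close> by blast
      ultimately show False using b0(2) span_base[of u "B - {b0}"] by blast
    qed
    show ?thesis
    proof (rule that[of "insert y ?B"])
      show "partial_barcode_basis (insert y ?B)"
        by (rule partial_barcode_basis_insert[OF b0(4) y]) (use y_not below b0(3) fresh dy in auto)
      show "insert y ?B \<subseteq> fil C k" using y Bk uk by blast
      show "span B \<subseteq> span (insert y ?B)" using b0(3) span_mono[of ?B "insert y ?B"] by blast
      have fin: "finite B" using B' by blast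
      have b0B: "b0 \<in> B" using U[OF b0(1)] by blast
      have "u \<notin> B - {b0}" using b0(2) span_base[of u "B - {b0}"] by blast
      then have "card ?B = Suc (card (B - {b0}))" using fin by simp
      also have "\<dots> = card B" using card.remove[OF fin b0B] by simp
      finally have "card ?B = card B" .
      moreover have "finite ?B" using fin by simp
      moreover have "y \<notin> ?B" using y_not b0(3) span_base[of y ?B] by auto
      ultimately show "card (insert y ?B) = Suc (card B)" by simp
    qed
  qed
qed

text \<open>A largest partial barcode basis spans. The extra condition that it lies in some step \<open>m\<close> and spans all
  lower steps fixes the order in which vectors are added, level by level; for the empty set it holds by
  \<open>fil_trivial\<close>.\<close>

lemma ex_barcode_basis:
  assumes "fin_dim C"
  shows "\<exists>B. barcode_basis C B"
proof -
  obtain B0 where B0: "finite B0" "span B0 = carr C"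
    using assms unfolding fin_dim_def by blast
  define P where "P B \<longleftrightarrow> partial_barcode_basis B \<and> (\<exists>m. B \<subseteq> fil C m \<and> fil C (m - 1) \<subseteq> span B)" for B
  obtain k0 where k0: "fil C k0 = {0}" using fil_trivial[OF assms] by blast
  have "partial_barcode_basis {}"
    unfolding partial_barcode_basis_def by (simp add: independent_empty)
  moreover have "{} \<subseteq> fil C (k0 + 1) \<and> fil C (k0 + 1 - 1) \<subseteq> span {}" using k0 by simp
  ultimately have "P {}" unfolding P_def by blast
  moreover have "card B < Suc (card B0)" if "P B" for B
  proof -
    have "independent B" "B \<subseteq> span B0"
      using that B0(2) unfolding P_def partial_barcode_basis_def by simp_all
    then show ?thesis using independent_span_bound[OF B0(1)] by (simp add: less_Suc_eq_le)
  qed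
  ultimately obtain B where B: "P B" and max: "\<And>B'. P B' \<Longrightarrow> card B' \<le> card B"
    using ex_has_greatest_nat[of P "{}" card "Suc (card B0)"] by blast
  obtain m where m: "partial_barcode_basis B" "B \<subseteq> fil C m" "fil C (m - 1) \<subseteq> span B"
    using B unfolding P_def by blast
  have "fil C (m + int n - 1) \<subseteq> span B" for n
  proof (induction n)
    case 0
    then show ?case using m(3) by simp
  next
    case (Suc n)
    show ?case
    proof (rule ccontr)
      assume neg: "\<not> fil C (m + int (Suc n) - 1) \<subseteq> span B"
      have "B \<subseteq> fil C (m + int n)" using m(2) fil_mono[of m "m + int n"] by auto
      then obtain B' where "partial_barcode_basis B'" "B' \<subseteq> fil C (m + int n)" "span B \<subseteq> span B'"
        "card B' = Suc (card B)"
        using partial_barcode_basis_step[OF m(1), of "m + int n"] Suc neg by auto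
      then have "P B'" "card B' > card B" using Suc unfolding P_def by auto
      then show False using max by fastforce
    qed
  qed
  note exhausts = this
  have "fil C k \<subseteq> span B" for k
  proof -
    have "k \<le> m + int (nat (k - m + 1)) - 1" by simp
    then show ?thesis using fil_mono exhausts by blast
  qed
  then have "carr C \<subseteq> span B" using fil_Union by blast
  moreover have "span B \<subseteq> carr C"
    using m(1) span_minimal[OF _ subspace_carr] unfolding partial_barcode_basis_def by blast
  ultimately show ?thesis using barcode_basis_if_spanning[OF m(1)] by blast
qed

end

context barcode_basis
begin

lemma fil_subset: "fil C k \<subseteq> carr C"
  using fil_eq[of k] span_mono[of "B \<inter> fil C k" B] carr_eq by blast

lemma subspace_fil: "subspace (fil C k)"
  using fil_eq[of k] subspace_span by metis

lemma subspace_grd: "subspace (grd C i)"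
  using grd_eq[of i] subspace_span by metis

lemma basis_subset: "B \<subseteq> carr C"
  using carr_eq span_superset by blast

lemma basis_nonzero: "b \<in> B \<Longrightarrow> b \<noteq> 0"
  using independent_basis dependent_zero by blast

lemma dif_zero: "dif C 0 = 0"
  by (rule linear_on_zero[OF _ _ _ dif_linear])
     (use vector_space_axioms carr_eq span_zero in auto)

lemma linear_extension_dif:
  obtains D where "Vector_Spaces.linear (scl C) (scl C) D" "\<And>x. x \<in> carr C \<Longrightarrow> D x = dif C x"
proof -
  interpret vector_space_pair "scl C" "scl C" ..
  show ?thesis using linear_on_extend[OF _ dif_linear] carr_eq that by auto
qed

lemma cycle_in_span:
  assumes "y \<in> carr C" "dif C y = 0"
  shows "y \<in> span {b \<in> B. dif C b = 0}"
proof -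
  obtain D where D: "Vector_Spaces.linear (scl C) (scl C) D" "\<And>x. x \<in> carr C \<Longrightarrow> D x = dif C x"
    using linear_extension_dif by blast
  interpret VP: vector_space_pair "scl C" "scl C" ..
  let ?Z = "{b \<in> B. dif C b = 0}" and ?N = "{b \<in> B. dif C b \<noteq> 0}"
  have DB: "D b = dif C b" if "b \<in> B" for b using D(2) basis_subset that by blast
  have "D ` ?N \<subseteq> B" using DB dif_basis by fastforce
  then have "independent (D ` ?N)" using independent_basis independent_mono by blast
  moreover have "inj_on D ?N"
    using dif_inj by (rule inj_on_cong[THEN iffD1, rotated]) (simp add: DB)
  moreover have "B = ?Z \<union> ?N" by blast
  then have "y \<in> span (?Z \<union> ?N)" using assms(1) carr_eq by simp
  moreover have "D y = 0" using assms D(2) by simp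
  moreover have "D z = 0" if "z \<in> ?Z" for z using that DB by simp
  ultimately show ?thesis using VP.kernel_in_span[OF D(1)] by blast
qed

end

section \<open>Counts of bars as homotopy invariants\<close>

text \<open>The cycles of degree \<open>i\<close> that are born by level \<open>q\<close> and not yet boundaries at level \<open>p\<close>. For
  \<open>q \<le> p\<close> their number is the rank of the map from the degree \<open>i\<close> homology of \<open>fil C q\<close> to that of
  \<open>fil C p\<close>.\<close>

definition survivors ::
    "('k::field, 'a::ab_group_add) filt_complex \<Rightarrow> 'a set \<Rightarrow> int \<Rightarrow> int \<Rightarrow> int \<Rightarrow> 'a set" where
  "survivors C B i q p =
     {b \<in> B \<inter> grd C i \<inter> fil C q. dif C b = 0 \<and> b \<notin> dif C ` (B \<inter> fil C p)}"

context barcode_basis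
begin

lemma survivors_subset: "survivors C B i q p \<subseteq> B"
  by (auto simp: survivors_def)

text \<open>In a barcode basis the coordinates of a cycle are themselves cycles, and they inherit degree and
  level. If none of them survives, each one bounds in level \<open>p\<close>.\<close>

lemma bounds_if_no_survivors:
  assumes y: "y \<in> grd C i" "y \<in> fil C q" "dif C y = 0" "y \<in> span (B - survivors C B i q p)"
  shows "y \<in> dif C ` fil C p"
proof -
  let ?T = "{b \<in> B. dif C b = 0} \<inter> ((B \<inter> grd C i) \<inter> ((B \<inter> fil C q) \<inter> (B - survivors C B i q p)))"
  have ycyc: "y \<in> span {b \<in> B. dif C b = 0}" using cycle_in_span y fil_subset by blast
  have yspan: "y \<in> span (B \<inter> grd C i)" "y \<in> span (B \<inter> fil C q)"
    using y grd_eq fil_eq by blast+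
  note Int = span_Int_independent[OF independent_basis]
  have 1: "y \<in> span ((B \<inter> fil C q) \<inter> (B - survivors C B i q p))"
    by (rule Int) (use yspan y(4) in auto)
  have 2: "y \<in> span ((B \<inter> grd C i) \<inter> ((B \<inter> fil C q) \<inter> (B - survivors C B i q p)))"
    by (rule Int[of "B \<inter> grd C i"]) (use yspan 1 in auto)
  have "y \<in> span ?T"
    by (rule Int[of "{b \<in> B. dif C b = 0}"]) (use ycyc 2 in auto)
  moreover have "?T \<subseteq> dif C ` (B \<inter> fil C p)"
    by (auto simp: survivors_def)
  ultimately have y': "y \<in> span (dif C ` (B \<inter> fil C p))" using span_mono by blast
  obtain D where D: "Vector_Spaces.linear (scl C) (scl C) D" "\<And>x. x \<in> carr C \<Longrightarrow> D x = dif C x"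
    using linear_extension_dif by blast
  interpret VP: vector_space_pair "scl C" "scl C" ..
  have "dif C ` (B \<inter> fil C p) = D ` (B \<inter> fil C p)"
    by (rule image_cong) (use D(2) basis_subset in auto)
  then have "y \<in> D ` span (B \<inter> fil C p)" using y' VP.linear_span_image[OF D(1)] by simp
  then show ?thesis using fil_eq[of p] D(2) fil_subset[of p] by force
qed

text \<open>The boundaries from level \<open>p\<close> are spanned by basis vectors that are disjoint from the survivors.\<close>

lemma boundary_of_survivors:
  assumes z: "z \<in> span (survivors C B i q p)" and w: "w \<in> fil C p" "z = dif C w"
  shows "z = 0"
proof -
  let ?T = "dif C ` (B \<inter> fil C p) - {0}"
  obtain D where D: "Vector_Spaces.linear (scl C) (scl C) D" "\<And>x. x \<in> carr C \<Longrightarrow> D x = dif C x"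
    using linear_extension_dif by blast
  interpret VP: vector_space_pair "scl C" "scl C" ..
  have "z = D w" using w D(2)[of w] fil_subset[of p] by auto
  moreover have "w \<in> span (B \<inter> fil C p)" using w fil_eq by blast
  ultimately have "z \<in> span (D ` (B \<inter> fil C p))" using VP.linear_span_image[OF D(1)] by blast
  moreover have "dif C ` (B \<inter> fil C p) = D ` (B \<inter> fil C p)"
    by (rule image_cong) (use D(2) basis_subset in auto)
  ultimately have "z \<in> span ?T" by (metis span_delete_0)
  moreover have "?T \<subseteq> B" using dif_basis by auto
  ultimately have "z \<in> span (survivors C B i q p \<inter> ?T)"
    using z by (intro span_Int_independent[OF independent_basis] survivors_subset)
  moreover have "survivors C B i q p \<inter> ?T = {}" by (auto simp: survivors_def)
  ultimately show ?thesis by simp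
qed

end

lemma filtered_chain_mapD:
  assumes "filtered_chain_map C D f"
  shows "linear_on (carr C) (scl C) (scl D) f"
    and "x \<in> grd C i \<Longrightarrow> f x \<in> grd D i"
    and "x \<in> fil C k \<Longrightarrow> f x \<in> fil D k"
    and "x \<in> carr C \<Longrightarrow> f (dif C x) = dif D (f x)"
  using assms unfolding filtered_chain_map_def by blast+

text \<open>Compose an equivalence \<open>f\<close> with the coordinate projection onto the survivors of the target. If the
  result vanishes on a combination \<open>z\<close> of survivors, then \<open>f z\<close> bounds in level \<open>p\<close>, hence so does
  \<open>g (f z)\<close>, and so does \<open>z\<close>, which differs from it by the boundary of \<open>h z\<close>; here \<open>q \<le> p\<close> puts \<open>h z\<close> into level
  \<open>p\<close>. Therefore \<open>z = 0\<close>: the composite is injective on the span of the survivors.\<close>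

lemma survivors_card_le:
  fixes C :: "('k::field, 'a::ab_group_add) filt_complex"
    and D :: "('k, 'b::ab_group_add) filt_complex"
  assumes "barcode_basis C B" "barcode_basis D A" and eqv: "filtered_homotopy_equivalent C D"
    and "q \<le> p"
  shows "card (survivors C B i q p) \<le> card (survivors D A i q p)"
proof -
  interpret C: barcode_basis C B by fact
  interpret D: barcode_basis D A by fact
  interpret VP: vector_space_pair "scl C" "scl D" ..
  interpret DD: vector_space_pair "scl D" "scl D" ..
  obtain f g where f: "filtered_chain_map C D f" and g: "filtered_chain_map D C g"
    and "filtered_homotopic C C (g \<circ> f) id"
    using eqv unfolding filtered_homotopy_equivalent_def by blast
  then obtain h where h: "linear_on (carr C) (scl C) (scl C) h" "\<And>k. h ` fil C k \<subseteq> fil C k"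
    "\<And>x. x \<in> carr C \<Longrightarrow> g (f x) - x = dif C (h x) + h (dif C x)"
    unfolding filtered_homotopic_def by auto
  obtain L where L: "Vector_Spaces.linear (scl C) (scl D) L" "\<And>x. x \<in> carr C \<Longrightarrow> L x = f x"
    using VP.linear_on_extend[of "carr C" f] f C.carr_eq unfolding filtered_chain_map_def by auto
  let ?S = "survivors C B i q p" and ?S' = "survivors D A i q p"
  obtain P where P: "Vector_Spaces.linear (scl D) (scl D) P"
    "\<And>a. a \<in> A \<Longrightarrow> P a = (if a \<in> ?S' then a else 0)"
    using DD.linear_independent_extend[OF D.independent_basis, of "\<lambda>a. if a \<in> ?S' then a else 0"]
    by blast
  let ?K = "P \<circ> L"
  have K: "Vector_Spaces.linear (scl C) (scl D) ?K"
    using Vector_Spaces.linear_compose[OF L(1) P(1)] .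
  have S_span: "C.span ?S \<subseteq> carr C \<inter> grd C i \<inter> fil C q"
  proof -
    have "?S \<subseteq> grd C i" "?S \<subseteq> fil C q" by (auto simp: survivors_def)
    then have "C.span ?S \<subseteq> grd C i" "C.span ?S \<subseteq> fil C q"
      by (simp_all add: C.span_minimal C.subspace_grd C.subspace_fil)
    then show ?thesis using C.fil_subset[of q] by blast
  qed
  have S_cycle: "dif C z = 0" if z: "z \<in> C.span ?S" for z
  proof -
    obtain E where E: "Vector_Spaces.linear (scl C) (scl C) E" "\<And>x. x \<in> carr C \<Longrightarrow> E x = dif C x"
      using C.linear_extension_dif by blast
    interpret CC: vector_space_pair "scl C" "scl C" ..
    have "E b = 0" if "b \<in> ?S" for b
      using that E(2)[of b] C.basis_subset by (auto simp: survivors_def)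
    then have "E z = 0" by (rule CC.linear_eq_0_on_span[OF E(1) _ z])
    then show ?thesis using E(2)[of z] z S_span by auto
  qed
  have PA: "P y \<in> D.span ?S' \<and> (P y = 0 \<longrightarrow> y \<in> D.span (A - ?S'))" if y: "y \<in> carr D" for y
  proof
    have "P ` A \<subseteq> D.span ?S'" using P(2) D.span_superset D.span_zero by auto
    then show "P y \<in> D.span ?S'"
      using DD.linear_image_span_subset[OF P(1) D.subspace_span, of A] y D.carr_eq by blast
    have "P ` ?S' = ?S'" using P(2) D.survivors_subset by (force simp: subset_iff)
    then have "D.independent (P ` ?S')"
      using D.independent_mono[OF D.independent_basis D.survivors_subset] by simp
    moreover have "inj_on P ?S'" using P(2) D.survivors_subset by (auto simp: inj_on_def subset_iff)
    moreover have "P z = 0" if "z \<in> A - ?S'" for z using that P(2) by simp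
    moreover have "A - ?S' \<union> ?S' = A" using D.survivors_subset by blast
    then have "y \<in> D.span (A - ?S' \<union> ?S')" using y D.carr_eq by simp
    ultimately show "P y = 0 \<longrightarrow> y \<in> D.span (A - ?S')"
      using DD.kernel_in_span[OF P(1)] by blast
  qed
  have "inj_on ?K (C.span ?S)"
    unfolding VP.linear_inj_on_iff_eq_0[OF K C.subspace_span]
  proof (intro ballI impI)
    fix z assume z: "z \<in> C.span ?S" and Kz: "?K z = 0"
    have zc: "z \<in> carr C" "z \<in> grd C i" "z \<in> fil C q" using z S_span by auto
    have dz: "dif C z = 0" using S_cycle z .
    have y: "f z \<in> grd D i" "f z \<in> fil D q" "dif D (f z) = f (dif C z)"
      using filtered_chain_mapD[OF f] zc by auto
    have "f 0 = 0"
      using L(2)[of 0] VP.linear_0[OF L(1)] C.carr_eq C.span_zero by auto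
    then have "dif D (f z) = 0" using y(3) dz by simp
    moreover have "f z \<in> D.span (A - ?S')"
      using PA[of "f z"] Kz L(2)[OF zc(1)] y(2) D.fil_subset[of q] by auto
    ultimately obtain w where w: "w \<in> fil D p" "f z = dif D w"
      using D.bounds_if_no_survivors y by blast
    have "g (f z) = dif C (g w)"
      using filtered_chain_mapD(4)[OF g, of w] w D.fil_subset[of p] by auto
    moreover have "h 0 = 0"
      by (rule linear_on_zero[OF _ _ _ h(1)]) (use C.vector_space_axioms C.carr_eq C.span_zero in auto)
    ultimately have "z = dif C (g w) - dif C (h z)"
      using h(3)[OF zc(1)] dz by (simp add: algebra_simps)
    moreover have gw: "g w \<in> fil C p" using filtered_chain_mapD(3)[OF g] w by blast
    moreover have hz: "h z \<in> fil C p" using h(2)[of q] zc(3) C.fil_mono[OF \<open>q \<le> p\<close>] by blast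
    moreover have "dif C (g w - h z) = dif C (g w) - dif C (h z)"
      by (rule linear_on_diff[OF _ _ _ C.dif_linear])
         (use C.vector_space_axioms C.carr_eq gw hz C.fil_subset[of p] in auto)
    ultimately show "z = 0"
      using C.boundary_of_survivors[OF z, of "g w - h z"] C.subspace_diff[OF C.subspace_fil] by simp
  qed
  then have ind: "D.independent (?K ` ?S)" and inj: "inj_on ?K ?S"
    using VP.linear_independent_injective_image[OF K, of ?S]
      C.independent_mono[OF C.independent_basis C.survivors_subset]
      inj_on_subset[OF _ C.span_superset[of ?S]] by blast+
  have "?K ` ?S \<subseteq> D.span ?S'"
  proof
    fix y assume "y \<in> ?K ` ?S"
    then obtain b where b: "b \<in> ?S" "y = P (L b)" by auto
    then have "b \<in> carr C" "b \<in> fil C q" using C.span_superset[of ?S] S_span by blast+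
    then have "L b \<in> carr D"
      using L(2)[of b] filtered_chain_mapD(3)[OF f] D.fil_subset[of q] by auto
    then show "y \<in> D.span ?S'" using PA b by blast
  qed
  moreover have "finite ?S'" by (rule finite_subset[OF D.survivors_subset D.finite_basis])
  ultimately have "card (?K ` ?S) \<le> card ?S'" using D.independent_span_bound[OF _ ind] by blast
  then show ?thesis using card_image[OF inj] by simp
qed

section \<open>Recovering the bars from the counts\<close>

lemma bij_betw_of_equal_fibres:
  fixes F :: "'t \<Rightarrow> 'a set" and G :: "'t \<Rightarrow> 'b set"
  assumes fin: "\<And>t. finite (F t)" "\<And>t. finite (G t)"
    and card: "\<And>t. card (F t) = card (G t)"
    and disj: "\<And>t t' x. x \<in> F t \<Longrightarrow> x \<in> F t' \<Longrightarrow> t = t'" "\<And>t t' x. x \<in> G t \<Longrightarrow> x \<in> G t' \<Longrightarrow> t = t'"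
  shows "\<exists>\<sigma>. bij_betw \<sigma> (\<Union>t. F t) (\<Union>t. G t) \<and> (\<forall>t. \<forall>x\<in>F t. \<sigma> x \<in> G t)"
proof -
  have "\<exists>s. bij_betw s (F t) (G t)" for t
    by (rule finite_same_card_bij[OF fin card])
  then obtain s where s: "\<And>t. bij_betw (s t) (F t) (G t)" by metis
  define \<sigma> where "\<sigma> x = s (THE t. x \<in> F t) x" for x
  have \<sigma>: "\<sigma> x = s t x" if "x \<in> F t" for x t
  proof -
    have "(THE t. x \<in> F t) = t" using that disj(1) by blast
    then show ?thesis by (simp add: \<sigma>_def)
  qed
  have G: "\<sigma> x \<in> G t" if "x \<in> F t" for x t
    using \<sigma>[OF that] s[of t] that bij_betwE by metis
  have "inj_on \<sigma> (\<Union>t. F t)"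
  proof (rule inj_onI)
    fix x y assume "x \<in> (\<Union>t. F t)" "y \<in> (\<Union>t. F t)" and eq: "\<sigma> x = \<sigma> y"
    then obtain t t' where t: "x \<in> F t" "y \<in> F t'" by blast
    then have "t = t'" using G eq disj(2) by metis
    then show "x = y"
      using \<sigma>[OF t(1)] \<sigma>[OF t(2)] t eq bij_betw_imp_inj_on[OF s[of t]] by (simp add: inj_on_eq_iff)
  qed
  moreover have "\<sigma> ` (\<Union>t. F t) = (\<Union>t. G t)"
  proof
    show "\<sigma> ` (\<Union>t. F t) \<subseteq> (\<Union>t. G t)" using G by blast
    show "(\<Union>t. G t) \<subseteq> \<sigma> ` (\<Union>t. F t)"
    proof
      fix y assume "y \<in> (\<Union>t. G t)"
      then obtain t where "y \<in> G t" by blast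
      then obtain x where x: "x \<in> F t" "y = s t x"
        using bij_betw_imp_surj_on[OF s[of t]] by blast
      then have "y = \<sigma> x" using \<sigma> by simp
      then show "y \<in> \<sigma> ` (\<Union>t. F t)" using x(1) by blast
    qed
  qed
  ultimately show ?thesis using G unfolding bij_betw_def by blast
qed

lemma int_upset_cases:
  fixes X :: "int set"
  assumes up: "\<And>p p'. p \<in> X \<Longrightarrow> p \<le> p' \<Longrightarrow> p' \<in> X" and q: "q \<notin> X" and ne: "X \<noteq> {}"
  obtains p where "q < p" "X = {p..}"
proof -
  have gt: "q < r" if "r \<in> X" for r using up[OF that] q by (meson not_less)
  obtain r where r: "r \<in> X" using ne by blast
  define n where "n = (LEAST n. q + int n \<in> X)"
  have "q + int (nat (r - q)) \<in> X" using r gt[OF r] by simp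
  then have n: "q + int n \<in> X" unfolding n_def by (rule LeastI)
  have "q + int n \<le> x" if x: "x \<in> X" for x
  proof -
    have "q + int (nat (x - q)) \<in> X" using x gt[OF x] by simp
    then have "n \<le> nat (x - q)" unfolding n_def by (rule Least_le)
    then show ?thesis using gt[OF x] by linarith
  qed
  then have "X = {q + int n..}" using up[OF n] by auto
  then show ?thesis using that gt[OF n] by blast
qed

text \<open>The type of a bar consists of the degree \<open>i\<close> and the level \<open>q\<close> of its cycle and of the set \<open>X\<close> of all
  levels at which the cycle bounds. By monotonicity \<open>X\<close> is empty for an infinite bar and \<open>{p..}\<close> for a bar that
  dies at \<open>p\<close>; a set covers both cases uniformly. The condition \<open>q \<notin> X\<close> excludes bars of length zero.\<close>

definition bars ::
    "('k::field, 'a::ab_group_add) filt_complex \<Rightarrow> 'a set \<Rightarrow> int \<times> int \<times> int set \<Rightarrow> 'a set" where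
  "bars C B = (\<lambda>(i, q, X). {b \<in> B \<inter> grd C i \<inter> fil C q.
     b \<notin> fil C (q - 1) \<and> dif C b = 0 \<and> {p. b \<in> dif C ` (B \<inter> fil C p)} = X \<and> q \<notin> X})"

text \<open>The cycles at the lower end of bars of positive or infinite length. Levels are compared through
  membership in all steps of the filtration.\<close>

definition essential :: "('k::field, 'a::ab_group_add) filt_complex \<Rightarrow> 'a set \<Rightarrow> 'a set" where
  "essential C B = {b \<in> B. dif C b = 0 \<and>
     (\<forall>c\<in>B. dif C c = b \<longrightarrow> (\<exists>k. b \<in> fil C k \<and> c \<notin> fil C k))}"

context barcode_basis
begin

lemma finite_bars: "finite (bars C B t)"
  using finite_basis by (auto simp: bars_def split: prod.split)

lemma finite_survivors: "finite (survivors C B i q p)"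
  by (rule finite_subset[OF survivors_subset finite_basis])

lemma death_times_up:
  "b \<in> dif C ` (B \<inter> fil C p) \<Longrightarrow> p \<le> p' \<Longrightarrow> b \<in> dif C ` (B \<inter> fil C p')"
  using fil_mono by blast

lemma bars_infinite_eq:
  assumes "B \<subseteq> fil C P" "q \<le> P"
  shows "bars C B (i, q, {}) = survivors C B i q P - survivors C B i (q - 1) P"
proof -
  define R where "R b p \<longleftrightarrow> b \<in> dif C ` (B \<inter> fil C p)" for b p
  have *: "{p. R b p} = {} \<longleftrightarrow> \<not> R b P" for b
    using assms(1) unfolding R_def by blast
  show ?thesis unfolding bars_def survivors_def R_def[symmetric] prod.case * by blast
qed

lemma bars_finite_eq:
  assumes "q < p"
  shows "bars C B (i, q, {p..}) =
    (survivors C B i q (p - 1) - survivors C B i (q - 1) (p - 1)) -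
    (survivors C B i q p - survivors C B i (q - 1) p)"
proof -
  \<comment> \<open>Death exactly at \<open>p\<close> means alive at \<open>p - 1\<close> and dead at \<open>p\<close>.\<close>
  have "{r. b \<in> dif C ` (B \<inter> fil C r)} = {p..} \<longleftrightarrow>
      b \<notin> dif C ` (B \<inter> fil C (p - 1)) \<and> b \<in> dif C ` (B \<inter> fil C p)" (is "?D = _ \<longleftrightarrow> ?R") for b
  proof
    assume eq: "?D = {p..}"
    have "p - 1 \<notin> ?D" "p \<in> ?D" unfolding eq by auto
    then show ?R by blast
  next
    assume R: ?R
    have "p \<le> r" if "r \<in> ?D" for r
    proof (rule ccontr)
      assume "\<not> p \<le> r"
      then have "r \<le> p - 1" by simp
      then show False using R death_times_up[of b r "p - 1"] that by blast
    qed
    moreover have "r \<in> ?D" if "p \<le> r" for r using R death_times_up[of b p r] that by blast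
    ultimately show "?D = {p..}" by auto
  qed
  note * = this
  define R where "R b p \<longleftrightarrow> b \<in> dif C ` (B \<inter> fil C p)" for b p
  have "q \<notin> {p..}" using assms by simp
  then show ?thesis
    using * unfolding bars_def survivors_def R_def[symmetric] prod.case by blast
qed

lemma bars_empty:
  assumes "X \<noteq> {}" "\<And>p. q < p \<Longrightarrow> X \<noteq> {p..}"
  shows "bars C B (i, q, X) = {}"
proof (rule ccontr)
  assume "bars C B (i, q, X) \<noteq> {}"
  then obtain b where b: "{p. b \<in> dif C ` (B \<inter> fil C p)} = X" "q \<notin> X"
    unfolding bars_def by auto
  have "p' \<in> X" if "p \<in> X" "p \<le> p'" for p p'
    using death_times_up[of b p p'] that unfolding b(1)[symmetric] by simp
  then obtain p where "q < p" "X = {p..}" using int_upset_cases[of X q] b(2) assms(1) by blast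
  then show False using assms(2) by blast
qed

lemma card_survivors_diff:
  "card (survivors C B i q p - survivors C B i (q - 1) p)
    = card (survivors C B i q p) - card (survivors C B i (q - 1) p)"
  using fil_mono[of "q - 1" q]
  by (intro card_Diff_subset finite_survivors) (auto simp: survivors_def)

lemma card_bars_finite:
  assumes "q < p"
  shows "card (bars C B (i, q, {p..})) =
    (card (survivors C B i q (p - 1)) - card (survivors C B i (q - 1) (p - 1))) -
    (card (survivors C B i q p) - card (survivors C B i (q - 1) p))"
proof -
  have "survivors C B i q p - survivors C B i (q - 1) p
      \<subseteq> survivors C B i q (p - 1) - survivors C B i (q - 1) (p - 1)"
    using death_times_up[of _ "p - 1" p] unfolding survivors_def by auto
  then show ?thesis
    unfolding bars_finite_eq[OF assms] card_survivors_diff[symmetric]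
    by (intro card_Diff_subset) (simp add: finite_survivors)
qed

lemma basis_bounded: "\<exists>P. \<forall>p\<ge>P. B \<subseteq> fil C p" if "(\<Union>k. fil C k) = carr C"
proof -
  have "\<exists>P. S \<subseteq> fil C P" if "finite S" "S \<subseteq> B" for S
    using that
  proof (induction rule: finite_induct)
    case empty
    then show ?case by simp
  next
    case (insert b S)
    then obtain P where P: "S \<subseteq> fil C P" by blast
    have "b \<in> carr C" using insert basis_subset by blast
    then obtain k where k: "b \<in> fil C k" using \<open>(\<Union>k. fil C k) = carr C\<close> by blast
    have "insert b S \<subseteq> fil C (max P k)"
      using P k fil_mono[of P "max P k"] fil_mono[of k "max P k"] by auto
    then show ?case by blast
  qed
  then obtain P where "B \<subseteq> fil C P" using finite_basis by blast
  then show ?thesis using fil_mono by blast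
qed

end

text \<open>The survivor counts determine the number of bars of each type by inclusion and exclusion: differences
  in \<open>q\<close> isolate the birth level and differences in \<open>p\<close> the death level. For infinite bars, \<open>p\<close> is a level beyond
  both filtrations. All counts in question have \<open>q \<le> p\<close>, including those at \<open>p - 1\<close>, since \<open>q < p\<close> for
  a bar of positive length.\<close>

lemma card_bars_eq:
  assumes "barcode_basis C B" "barcode_basis D A"
    and ex: "(\<Union>k. fil C k) = carr C" "(\<Union>k. fil D k) = carr D"
    and eq: "\<And>i q p. q \<le> p \<Longrightarrow> card (survivors C B i q p) = card (survivors D A i q p)"
  shows "card (bars C B t) = card (bars D A t)"
proof -
  interpret C: barcode_basis C B by fact
  interpret D: barcode_basis D A by fact
  obtain i q X where t: "t = (i, q, X)" by (cases t)
  consider "X = {}" | p where "q < p" "X = {p..}" | "X \<noteq> {}" "\<And>p. q < p \<Longrightarrow> X \<noteq> {p..}" by blast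
  then show ?thesis
  proof cases
    case 1
    obtain P1 where P1: "\<forall>p\<ge>P1. B \<subseteq> fil C p" using C.basis_bounded[OF ex(1)] by blast
    obtain P2 where P2: "\<forall>p\<ge>P2. A \<subseteq> fil D p" using D.basis_bounded[OF ex(2)] by blast
    let ?P = "max q (max P1 P2)"
    show ?thesis
      unfolding t 1 using P1 P2 C.bars_infinite_eq[of ?P q i] D.bars_infinite_eq[of ?P q i]
      by (simp add: C.card_survivors_diff D.card_survivors_diff eq)
  next
    case 2
    then show ?thesis
      by (simp add: t C.card_bars_finite D.card_bars_finite eq)
  next
    case 3
    then show ?thesis by (simp add: t C.bars_empty D.bars_empty)
  qed
qed

text \<open>A cycle born at level \<open>q\<close> is essential iff it does not bound in level \<open>q\<close>.\<close>

lemma bars_UN: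
  assumes "filtered_complex C" "barcode_basis C B"
  shows "(\<Union>t. bars C B t) = essential C B"
proof -
  interpret C: filtered_complex C by fact
  interpret B: barcode_basis C B by fact
  show ?thesis
  proof
    show "(\<Union>t. bars C B t) \<subseteq> essential C B"
    proof
      fix b assume "b \<in> (\<Union>t. bars C B t)"
      then obtain i q X where "b \<in> bars C B (i, q, X)" by auto
      then have b: "b \<in> B" "b \<in> fil C q" "dif C b = 0" "b \<notin> dif C ` (B \<inter> fil C q)"
        unfolding bars_def by auto
      then show "b \<in> essential C B" unfolding essential_def by blast
    qed
    show "essential C B \<subseteq> (\<Union>t. bars C B t)"
    proof
      fix b assume e: "b \<in> essential C B"
      then have b: "b \<in> B" "dif C b = 0" unfolding essential_def by auto
      obtain i where i: "b \<in> grd C i" using B.basis_homogeneous b by blast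
      obtain q where q: "b \<in> fil C q" "b \<notin> fil C (q - 1)"
        using C.level_exists B.basis_subset B.basis_nonzero b by blast
      have "b \<notin> dif C ` (B \<inter> fil C q)"
      proof
        assume "b \<in> dif C ` (B \<inter> fil C q)"
        then obtain c where c: "c \<in> B" "c \<in> fil C q" "dif C c = b" by blast
        then obtain k where k: "b \<in> fil C k" "c \<notin> fil C k" using e unfolding essential_def by blast
        then have "q \<le> k" using q(2) C.fil_mono[of k "q - 1"] by fastforce
        then show False using C.fil_mono c(2) k(2) by blast
      qed
      then have "b \<in> bars C B (i, q, {p. b \<in> dif C ` (B \<inter> fil C p)})"
        using b i q unfolding bars_def by simp
      then show "b \<in> (\<Union>t. bars C B t)" by blast
    qed
  qed
qed

lemma bars_disjoint:
  assumes "filtered_complex C" "barcode_basis C B" and b: "b \<in> bars C B t" "b \<in> bars C B t'"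
  shows "t = t'"
proof -
  interpret C: filtered_complex C by fact
  interpret B: barcode_basis C B by fact
  obtain i q X i' q' X' where t: "t = (i, q, X)" "t' = (i', q', X')" by (cases t, cases t')
  have *: "b \<in> B" "b \<in> grd C i" "b \<in> grd C i'" "X = X'"
    "b \<in> fil C q" "b \<notin> fil C (q - 1)" "b \<in> fil C q'" "b \<notin> fil C (q' - 1)"
    using b unfolding t bars_def by auto
  have "i = i'" using C.degree_unique * B.basis_nonzero by blast
  moreover have "\<not> q < q'" "\<not> q' < q"
    using * C.fil_mono[of q "q' - 1"] C.fil_mono[of q' "q - 1"] by auto
  ultimately show ?thesis using t * by simp
qed

lemma same_bar_fil:
  assumes "filtered_complex C" "filtered_complex D"
    and b: "b \<in> bars C B t" "c \<in> bars D A t" "b \<in> fil C k"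
  shows "c \<in> fil D k"
proof -
  interpret C: filtered_complex C by fact
  interpret D: filtered_complex D by fact
  obtain i q X where t: "t = (i, q, X)" by (cases t)
  have *: "b \<notin> fil C (q - 1)" "c \<in> fil D q" using b unfolding t bars_def by auto
  then have "q \<le> k" using b(3) C.fil_mono[of k "q - 1"] by fastforce
  then show ?thesis using D.fil_mono * by blast
qed

section \<open>Homotopy equivalence from a matching of bars\<close>

definition nontrivial :: "('k::field, 'a::ab_group_add) filt_complex \<Rightarrow> 'a set \<Rightarrow> 'a set" where
  "nontrivial C B = {b \<in> B. b \<in> essential C B \<or> dif C b \<in> essential C B}"

text \<open>A map of basis vectors that matches bars of positive length and kills those of length zero. The
  equation \<open>\<phi> 0 = 0\<close> is contained in the last clause, as \<open>0\<close> is no basis vector, so that the condition on differentials also covers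
  cycles.\<close>

definition bar_map ::
    "('k::field, 'a::ab_group_add) filt_complex \<Rightarrow> 'a set \<Rightarrow>
     ('k, 'b::ab_group_add) filt_complex \<Rightarrow> 'b set \<Rightarrow> ('a \<Rightarrow> 'b) \<Rightarrow> bool" where
  "bar_map C B D A \<phi> \<longleftrightarrow>
     (\<forall>b\<in>nontrivial C B. \<phi> b \<in> nontrivial D A \<and> (\<forall>i. b \<in> grd C i \<longrightarrow> \<phi> b \<in> grd D i) \<and>
        (\<forall>k. b \<in> fil C k \<longrightarrow> \<phi> b \<in> fil D k) \<and> dif D (\<phi> b) = \<phi> (dif C b)) \<and>
     (\<forall>b. b \<notin> nontrivial C B \<longrightarrow> \<phi> b = 0)"

lemma basis_map_extends:
  assumes "barcode_basis C B" "barcode_basis D A"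
    and grd: "\<And>b i. b \<in> B \<Longrightarrow> b \<in> grd C i \<Longrightarrow> \<phi> b \<in> grd D (i + s)"
    and fil: "\<And>b k. b \<in> B \<Longrightarrow> b \<in> fil C k \<Longrightarrow> \<phi> b \<in> fil D k"
  shows "\<exists>f. Vector_Spaces.linear (scl C) (scl D) f \<and> (\<forall>b\<in>B. f b = \<phi> b) \<and>
    (\<forall>i. f ` grd C i \<subseteq> grd D (i + s)) \<and> (\<forall>k. f ` fil C k \<subseteq> fil D k)"
proof -
  interpret C: barcode_basis C B by fact
  interpret D: barcode_basis D A by fact
  interpret VP: vector_space_pair "scl C" "scl D" ..
  obtain f where f: "Vector_Spaces.linear (scl C) (scl D) f" "\<forall>b\<in>B. f b = \<phi> b"
    using VP.linear_independent_extend[OF C.independent_basis] by blast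
  have "f ` (B \<inter> grd C i) \<subseteq> grd D (i + s)" "f ` (B \<inter> fil C k) \<subseteq> fil D k" for i k
    using f(2) grd fil by auto
  then have "f ` C.span (B \<inter> grd C i) \<subseteq> grd D (i + s)" "f ` C.span (B \<inter> fil C k) \<subseteq> fil D k" for i k
    using VP.linear_image_span_subset[OF f(1)] D.subspace_grd D.subspace_fil by simp_all
  then show ?thesis
    using f by (intro exI[of _ f]) (simp add: C.grd_eq[symmetric] C.fil_eq[symmetric])
qed

lemma (in barcode_basis) nontrivial_facts:
  assumes cyc: "\<forall>b\<in>B. dif C (dif C b) = 0"
  shows "0 \<notin> nontrivial C B" and "b \<in> nontrivial C B \<Longrightarrow> dif C b \<in> nontrivial C B \<or> dif C b = 0"
    and "b \<in> B \<Longrightarrow> b \<notin> nontrivial C B \<Longrightarrow> dif C b \<notin> nontrivial C B"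
proof -
  have ess: "b \<in> essential C B \<Longrightarrow> b \<in> B \<and> dif C b = 0 \<and> b \<noteq> 0" for b
    using basis_nonzero by (auto simp: essential_def)
  show "0 \<notin> nontrivial C B" using basis_nonzero by (auto simp: nontrivial_def)
  show "b \<in> nontrivial C B \<Longrightarrow> dif C b \<in> nontrivial C B \<or> dif C b = 0"
    using ess unfolding nontrivial_def by blast
  show "b \<in> B \<Longrightarrow> b \<notin> nontrivial C B \<Longrightarrow> dif C b \<notin> nontrivial C B"
    using ess[of "dif C (dif C b)"] cyc unfolding nontrivial_def by auto
qed

lemma bar_map_chain_map:
  assumes "filtered_complex C" "barcode_basis C B" "filtered_complex D" "barcode_basis D A"
    and \<phi>: "bar_map C B D A \<phi>"
  obtains f where "Vector_Spaces.linear (scl C) (scl D) f" "\<And>b. b \<in> B \<Longrightarrow> f b = \<phi> b"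
    "filtered_chain_map C D f"
proof -
  interpret FC: filtered_complex C by fact
  interpret C: barcode_basis C B by fact
  interpret FD: filtered_complex D by fact
  interpret D: barcode_basis D A by fact
  interpret VP: vector_space_pair "scl C" "scl D" ..
  let ?N = "nontrivial C B"
  have cyc: "\<forall>b\<in>B. dif C (dif C b) = 0" using FC.dif_dif C.basis_subset by blast
  note N = C.nontrivial_facts[OF cyc]
  have \<phi>N: "\<phi> b \<in> nontrivial D A" "b \<in> grd C i \<Longrightarrow> \<phi> b \<in> grd D i"
    "b \<in> fil C k \<Longrightarrow> \<phi> b \<in> fil D k" "dif D (\<phi> b) = \<phi> (dif C b)" if "b \<in> ?N" for b i k
    using \<phi> that unfolding bar_map_def by blast+
  have \<phi>0: "\<phi> b = 0" if "b \<notin> ?N" for b using \<phi> that unfolding bar_map_def by blast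
  have grd: "\<phi> b \<in> grd D (i + 0)" if "b \<in> B" "b \<in> grd C i" for b i
    using that \<phi>N(2)[of b i] \<phi>0[of b] FD.subspace_0[OF FD.subspace_grd] by (cases "b \<in> ?N") auto
  have fil: "\<phi> b \<in> fil D k" if "b \<in> B" "b \<in> fil C k" for b k
    using that \<phi>N(3)[of b k] \<phi>0[of b] FD.subspace_0[OF FD.subspace_fil] by (cases "b \<in> ?N") auto
  obtain f where "Vector_Spaces.linear (scl C) (scl D) f \<and> (\<forall>b\<in>B. f b = \<phi> b) \<and>
      (\<forall>i. f ` grd C i \<subseteq> grd D (i + 0)) \<and> (\<forall>k. f ` fil C k \<subseteq> fil D k)"
    using basis_map_extends[of C B D A \<phi> 0, OF \<open>barcode_basis C B\<close> \<open>barcode_basis D A\<close> grd fil] ..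
  then have f: "Vector_Spaces.linear (scl C) (scl D) f" "\<And>b. b \<in> B \<Longrightarrow> f b = \<phi> b"
    "\<And>i. f ` grd C i \<subseteq> grd D (i + 0)" "\<And>k. f ` fil C k \<subseteq> fil D k" by blast+
  obtain dC where dC: "Vector_Spaces.linear (scl C) (scl C) dC" "\<And>x. x \<in> carr C \<Longrightarrow> dC x = dif C x"
    using C.linear_extension_dif by blast
  obtain dD where dD: "Vector_Spaces.linear (scl D) (scl D) dD" "\<And>x. x \<in> carr D \<Longrightarrow> dD x = dif D x"
    using D.linear_extension_dif by blast
  have f_carr: "f x \<in> carr D" if x: "x \<in> carr C" for x
  proof -
    obtain k where "x \<in> fil C k" using x FC.fil_Union by blast
    then show ?thesis using f(4)[of k] D.fil_subset[of k] by blast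
  qed
  have f0: "f 0 = 0" by (rule VP.linear_0[OF f(1)])
  have basis: "(f \<circ> dC) b = (dD \<circ> f) b" if b: "b \<in> B" for b
  proof -
    have bc: "b \<in> carr C" using b C.basis_subset by blast
    have "f (dif C b) = \<phi> (dif C b)"
      using C.dif_basis[OF b] f(2) f0 \<phi>0[OF N(1)] by auto
    also have "\<dots> = dif D (\<phi> b)"
      using \<phi>N(4) \<phi>0 N(3)[OF b] FD.dif_zero by (cases "b \<in> ?N") auto
    finally show ?thesis using dC(2)[OF bc] dD(2)[OF f_carr[OF bc]] f(2)[OF b] by simp
  qed
  have "f (dif C x) = dif D (f x)" if x: "x \<in> carr C" for x
  proof -
    have "(f \<circ> dC) x = (dD \<circ> f) x"
      by (rule VP.linear_eq_on_span[OF Vector_Spaces.linear_compose[OF dC(1) f(1)]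
            Vector_Spaces.linear_compose[OF f(1) dD(1)] basis])
         (use x C.carr_eq in auto)
    then show ?thesis using dC(2) dD(2) f_carr x by simp
  qed
  then have "filtered_chain_map C D f"
    using f(3,4) VP.linear_add[OF f(1)] VP.linear_scale[OF f(1)]
    unfolding filtered_chain_map_def linear_on_def by simp
  then show ?thesis using that f(1,2) by blast
qed

text \<open>When \<open>g \<circ> f\<close> is the projection that kills the bars of length zero, these are contracted by
  the homotopy \<open>dif C c \<mapsto> - c\<close>. It respects the filtration because \<open>c\<close> and \<open>dif C c\<close> have the same level.\<close>

lemma bar_maps_homotopic_id:
  assumes "filtered_complex C" "barcode_basis C B" and "vector_space (scl D)"
    and f: "Vector_Spaces.linear (scl C) (scl D) f" and g: "Vector_Spaces.linear (scl D) (scl C) g"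
    and gf: "\<And>b. b \<in> B \<Longrightarrow> g (f b) = (if b \<in> nontrivial C B then b else 0)"
  shows "filtered_homotopic C C (g \<circ> f) id"
proof -
  interpret FC: filtered_complex C by fact
  interpret C: barcode_basis C B by fact
  interpret VP: vector_space_pair "scl C" "scl C" ..
  let ?N = "nontrivial C B"
  have cyc: "\<forall>b\<in>B. dif C (dif C b) = 0" using FC.dif_dif C.basis_subset by blast
  note N = C.nontrivial_facts[OF cyc]
  have inj: "c = c'" if "c \<in> B" "c' \<in> B" "dif C c = dif C c'" "dif C c \<noteq> 0" for c c'
    using C.dif_inj that unfolding inj_on_def by auto
  define \<eta> where "\<eta> b = (if b \<in> B \<and> b \<notin> ?N \<and> b \<in> dif C ` B then - (SOME c. c \<in> B \<and> dif C c = b) else 0)" for b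
  have \<eta>: "\<eta> (dif C c) = - c" if c: "c \<in> B" "dif C c \<in> B" "dif C c \<notin> ?N" for c
  proof -
    have "(SOME c'. c' \<in> B \<and> dif C c' = dif C c) = c"
      by (rule some_equality) (use c inj C.basis_nonzero in auto)
    then show ?thesis using c by (simp add: \<eta>_def)
  qed
  have \<eta>_cases: "\<eta> b = 0 \<or> (\<exists>c\<in>B. b = dif C c \<and> \<eta> b = - c \<and> b \<in> B \<and> b \<notin> ?N)" for b
    using \<eta> unfolding \<eta>_def by auto
  \<comment> \<open>\<open>\<eta> b\<close> is zero or, up to sign, the upper end of a bar of length zero with lower end \<open>b\<close>.\<close>
  have grd: "\<eta> b \<in> grd C (i + 1)" if b: "b \<in> B" "b \<in> grd C i" for b i
    using \<eta>_cases[of b]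
  proof
    assume "\<eta> b = 0"
    then show ?thesis using FC.subspace_0[OF FC.subspace_grd] by simp
  next
    assume "\<exists>c\<in>B. b = dif C c \<and> \<eta> b = - c \<and> b \<in> B \<and> b \<notin> ?N"
    then obtain c where c: "c \<in> B" "b = dif C c" "\<eta> b = - c" by blast
    obtain j where j: "c \<in> grd C j" using C.basis_homogeneous c(1) by blast
    obtain k where k: "c \<in> fil C k" using C.basis_subset c(1) FC.fil_Union by blast
    have "b \<in> grd C (j - 1)" using FC.dif_fil_grd[of k j] j k c(2) by blast
    then have "i = j - 1" using FC.degree_unique b C.basis_nonzero by blast
    then show ?thesis using c(3) j FC.subspace_neg[OF FC.subspace_grd] by simp
  qed
  have fil: "\<eta> b \<in> fil C k" if b: "b \<in> B" "b \<in> fil C k" for b k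
    using \<eta>_cases[of b]
  proof
    assume "\<eta> b = 0"
    then show ?thesis using FC.subspace_0[OF FC.subspace_fil] by simp
  next
    assume "\<exists>c\<in>B. b = dif C c \<and> \<eta> b = - c \<and> b \<in> B \<and> b \<notin> ?N"
    then obtain c where c: "c \<in> B" "b = dif C c" "\<eta> b = - c" "b \<notin> ?N" by blast
    have "b \<notin> essential C B" "dif C b = 0" using c b cyc by (auto simp: nontrivial_def)
    then obtain c' where c': "c' \<in> B" "dif C c' = b" "\<forall>k. b \<in> fil C k \<longrightarrow> c' \<in> fil C k"
      using b unfolding essential_def by blast
    have "c' = c" using inj c' c b C.basis_nonzero by blast
    then show ?thesis using c' c(3) b(2) FC.subspace_neg[OF FC.subspace_fil] by simp
  qed
  obtain h where "Vector_Spaces.linear (scl C) (scl C) h \<and> (\<forall>b\<in>B. h b = \<eta> b) \<and>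
      (\<forall>i. h ` grd C i \<subseteq> grd C (i + 1)) \<and> (\<forall>k. h ` fil C k \<subseteq> fil C k)"
    using basis_map_extends[of C B C B \<eta> 1, OF \<open>barcode_basis C B\<close> \<open>barcode_basis C B\<close> grd fil] ..
  then have h: "Vector_Spaces.linear (scl C) (scl C) h" "\<And>b. b \<in> B \<Longrightarrow> h b = \<eta> b"
    "\<And>i. h ` grd C i \<subseteq> grd C (i + 1)" "\<And>k. h ` fil C k \<subseteq> fil C k" by blast+
  obtain d where d: "Vector_Spaces.linear (scl C) (scl C) d" "\<And>x. x \<in> carr C \<Longrightarrow> d x = dif C x"
    using C.linear_extension_dif by blast
  have h_carr: "h x \<in> carr C" if x: "x \<in> carr C" for x
  proof -
    obtain k where "x \<in> fil C k" using x FC.fil_Union by blast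
    then show ?thesis using h(4)[of k] C.fil_subset[of k] by blast
  qed
  have h0: "h 0 = 0" by (rule VP.linear_0[OF h(1)])
  have db: "d b = dif C b" if "b \<in> B" for b using d(2) C.basis_subset that by blast
  have basis: "(g \<circ> f) b - id b = (d \<circ> h) b + (h \<circ> d) b" if b: "b \<in> B" for b
  proof (cases "b \<in> ?N")
    case True
    have "h (dif C b) = 0"
    proof (cases "dif C b = 0")
      case False
      then have "dif C b \<in> ?N" using N(2)[OF True] by blast
      then have "\<eta> (dif C b) = 0" by (simp add: \<eta>_def)
      then show ?thesis using h(2) C.dif_basis[OF b] False by auto
    qed (simp add: h0)
    moreover have "h b = 0" using h(2)[OF b] True by (simp add: \<eta>_def)
    moreover have "d 0 = 0" by (rule VP.linear_0[OF d(1)])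
    ultimately show ?thesis using gf[OF b] True db[OF b] by simp
  next
    case False
    show ?thesis
    proof (cases "dif C b = 0")
      case True
      have "b \<notin> essential C B" using False b by (auto simp: nontrivial_def)
      then obtain c where c: "c \<in> B" "dif C c = b"
        using b True unfolding essential_def by blast
      then have "h b = - c" using h(2)[OF b] \<eta>[of c] b False by simp
      moreover have "d (- c) = - b" using VP.linear_neg[OF d(1)] db[OF c(1)] c(2) by simp
      ultimately show ?thesis using gf[OF b] False db[OF b] True h0 by simp
    next
      case nz: False
      then have "dif C b \<in> B" using C.dif_basis[OF b] by simp
      then have "h (dif C b) = - b" using h(2) \<eta>[OF b] N(3)[OF b False] by simp
      moreover have "b \<notin> dif C ` B" using nz cyc by auto
      then have "h b = 0" using h(2)[OF b] by (simp add: \<eta>_def)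
      moreover have "d 0 = 0" by (rule VP.linear_0[OF d(1)])
      ultimately show ?thesis using gf[OF b] False db[OF b] by simp
    qed
  qed
  have l1: "Vector_Spaces.linear (scl C) (scl C) (\<lambda>x. (g \<circ> f) x - id x)"
    by (rule VP.linear_compose_sub[OF Vector_Spaces.linear_compose[OF f g] FC.linear_id])
  have l2: "Vector_Spaces.linear (scl C) (scl C) (\<lambda>x. (d \<circ> h) x + (h \<circ> d) x)"
    by (rule VP.linear_compose_add[OF Vector_Spaces.linear_compose[OF h(1) d(1)]
          Vector_Spaces.linear_compose[OF d(1) h(1)]])
  have eq: "(g \<circ> f) x - id x = (d \<circ> h) x + (h \<circ> d) x" if "x \<in> FC.span B" for x
    by (rule VP.linear_eq_on_span[OF l1 l2 _ that]) (rule basis)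
  have "(g \<circ> f) x - id x = dif C (h x) + h (dif C x)" if x: "x \<in> carr C" for x
    using eq[of x] x C.carr_eq d(2)[OF x] d(2)[OF h_carr[OF x]] by simp
  then show ?thesis
    unfolding filtered_homotopic_def
    using h(3,4) VP.linear_add[OF h(1)] VP.linear_scale[OF h(1)]
    by (intro exI[of _ h]) (simp add: linear_on_def)
qed

text \<open>A type-preserving map \<open>\<sigma>\<close> between the lower ends of the bars extends to the upper ends: the image of
  \<open>c\<close> is the basis vector that bounds \<open>\<sigma> (dif C c)\<close>.\<close>

definition bar_extension ::
    "('k::field, 'a::ab_group_add) filt_complex \<Rightarrow> 'a set \<Rightarrow>
     ('k, 'b::ab_group_add) filt_complex \<Rightarrow> 'b set \<Rightarrow> ('a \<Rightarrow> 'b) \<Rightarrow> 'a \<Rightarrow> 'b" where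
  "bar_extension C B D A \<sigma> b =
     (if b \<in> essential C B then \<sigma> b
      else if b \<in> nontrivial C B then (SOME c. c \<in> A \<and> dif D c = \<sigma> (dif C b))
      else 0)"

text \<open>Since \<open>\<sigma>\<close> preserves the set of levels at which a cycle bounds, the upper end of the image bar exists and
  has level no higher than the given upper end.\<close>

lemma bar_extension_facts:
  assumes "filtered_complex C" "barcode_basis C B" "filtered_complex D" "barcode_basis D A"
    and \<sigma>: "\<And>t b. b \<in> bars C B t \<Longrightarrow> \<sigma> b \<in> bars D A t"
  shows "bar_map C B D A (bar_extension C B D A \<sigma>)"
    and "b \<in> nontrivial C B \<Longrightarrow> b \<notin> essential C B \<Longrightarrow>
      bar_extension C B D A \<sigma> b \<in> A \<and> dif D (bar_extension C B D A \<sigma> b) = \<sigma> (dif C b)"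
proof -
  interpret FC: filtered_complex C by fact
  interpret C: barcode_basis C B by fact
  interpret FD: filtered_complex D by fact
  interpret D: barcode_basis D A by fact
  let ?\<phi> = "bar_extension C B D A \<sigma>"
  have EC: "(\<Union>t. bars C B t) = essential C B" by (rule bars_UN) fact+
  have ED: "(\<Union>t. bars D A t) = essential D A" by (rule bars_UN) fact+
  have injD: "c = c'" if "c \<in> A" "c' \<in> A" "dif D c = dif D c'" "dif D c \<noteq> 0" for c c'
    using D.dif_inj that unfolding inj_on_def by auto
  have essD: "y \<in> A \<and> dif D y = 0 \<and> y \<noteq> 0" if "y \<in> essential D A" for y
    using that D.basis_nonzero by (auto simp: essential_def)
  have essC: "y \<in> B \<and> dif C y = 0" if "y \<in> essential C B" for y
    using that by (auto simp: essential_def)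
  have \<sigma>E: "\<sigma> b \<in> essential D A" if "b \<in> essential C B" for b
    using that \<sigma> unfolding EC[symmetric] ED[symmetric] by blast
  have top: "?\<phi> b \<in> A \<and> dif D (?\<phi> b) = \<sigma> (dif C b) \<and> (\<forall>k. b \<in> fil C k \<longrightarrow> ?\<phi> b \<in> fil D k)
      \<and> (\<forall>i. b \<in> grd C i \<longrightarrow> ?\<phi> b \<in> grd D i)"
    if b: "b \<in> nontrivial C B" "b \<notin> essential C B" for b
  proof -
    have bB: "b \<in> B" and e: "dif C b \<in> essential C B" using b by (auto simp: nontrivial_def)
    obtain i q X where t: "dif C b \<in> bars C B (i, q, X)"
      using e unfolding EC[symmetric] by (metis UN_E prod_cases3)
    then have st: "\<sigma> (dif C b) \<in> bars D A (i, q, X)" by (rule \<sigma>)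
    have nz: "\<sigma> (dif C b) \<noteq> 0" using essD[OF \<sigma>E[OF e]] by blast
    have ex: "\<exists>c. c \<in> A \<inter> fil D k \<and> dif D c = \<sigma> (dif C b)" if k: "b \<in> fil C k" for k
    proof -
      have "k \<in> X" using t bB k unfolding bars_def by auto
      then have "\<sigma> (dif C b) \<in> dif D ` (A \<inter> fil D k)" using st unfolding bars_def by auto
      then show ?thesis by force
    qed
    have bc: "b \<in> carr C" using bB C.basis_subset by blast
    then obtain k0 where k0: "b \<in> fil C k0" using FC.fil_Union by blast
    have some: "?\<phi> b \<in> A \<and> dif D (?\<phi> b) = \<sigma> (dif C b)"
    proof -
      have "?\<phi> b = (SOME c. c \<in> A \<and> dif D c = \<sigma> (dif C b))" using b by (simp add: bar_extension_def)
      moreover have "\<exists>c. c \<in> A \<and> dif D c = \<sigma> (dif C b)" using ex[OF k0] by blast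
      ultimately show ?thesis using someI_ex[of "\<lambda>c. c \<in> A \<and> dif D c = \<sigma> (dif C b)"] by simp
    qed
    have "?\<phi> b \<in> fil D k" if k: "b \<in> fil C k" for k
    proof -
      obtain c where c: "c \<in> A \<inter> fil D k" "dif D c = \<sigma> (dif C b)" using ex[OF k] by blast
      then have "c = ?\<phi> b" using some injD nz by (metis IntD1)
      then show ?thesis using c by blast
    qed
    moreover have "?\<phi> b \<in> grd D j" if j: "b \<in> grd C j" for j
    proof -
      have "dif C b \<in> grd C (j - 1)" using FC.dif_fil_grd[of k0 j] k0 j by blast
      moreover have "dif C b \<in> grd C i" "dif C b \<in> B" using t unfolding bars_def by auto
      ultimately have i: "i = j - 1" using FC.degree_unique C.basis_nonzero by blast
      obtain m where m: "?\<phi> b \<in> grd D m" using D.basis_homogeneous some by blast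
      obtain l where l: "?\<phi> b \<in> fil D l" using FD.fil_Union D.basis_subset some by blast
      have "\<sigma> (dif C b) \<in> grd D (m - 1)" using FD.dif_fil_grd[of l m] l m some by force
      moreover have "\<sigma> (dif C b) \<in> grd D i" using st unfolding bars_def by auto
      ultimately have "m - 1 = i" using FD.degree_unique nz by blast
      then show ?thesis using m i by simp
    qed
    ultimately show ?thesis using some by blast
  qed
  show "b \<in> nontrivial C B \<Longrightarrow> b \<notin> essential C B \<Longrightarrow>
      ?\<phi> b \<in> A \<and> dif D (?\<phi> b) = \<sigma> (dif C b)"
    using top by blast
  have \<phi>E: "?\<phi> b = \<sigma> b" if "b \<in> essential C B" for b using that by (simp add: bar_extension_def)
  have E_N: "essential C B \<subseteq> nontrivial C B" by (auto simp: nontrivial_def essential_def)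
  show "bar_map C B D A ?\<phi>"
    unfolding bar_map_def
  proof (intro conjI ballI allI impI)
    fix b assume "b \<notin> nontrivial C B"
    then show "?\<phi> b = 0" using E_N by (auto simp: bar_extension_def)
  next
    fix b assume b: "b \<in> nontrivial C B"
    have "?\<phi> b \<in> nontrivial D A \<and> (\<forall>i. b \<in> grd C i \<longrightarrow> ?\<phi> b \<in> grd D i) \<and>
        (\<forall>k. b \<in> fil C k \<longrightarrow> ?\<phi> b \<in> fil D k) \<and> dif D (?\<phi> b) = ?\<phi> (dif C b)"
    proof (cases "b \<in> essential C B")
      case True
      obtain i q X where t: "b \<in> bars C B (i, q, X)"
        using True unfolding EC[symmetric] by (metis UN_E prod_cases3)
      then have st: "\<sigma> b \<in> bars D A (i, q, X)" by (rule \<sigma>)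
      have "i = j" if "b \<in> grd C j" for j
        using FC.degree_unique[of b i j] that t essC[OF True] C.basis_nonzero
        unfolding bars_def by auto
      moreover have "\<sigma> b \<in> grd D i" using st unfolding bars_def by auto
      moreover have "\<sigma> b \<in> fil D k" if "b \<in> fil C k" for k
        using same_bar_fil[OF \<open>filtered_complex C\<close> \<open>filtered_complex D\<close> t st that] .
      moreover have "?\<phi> 0 = 0"
        using C.basis_nonzero E_N by (auto simp: bar_extension_def nontrivial_def)
      ultimately show ?thesis
        using \<phi>E[OF True] \<sigma>E[OF True] essD[OF \<sigma>E[OF True]] essC[OF True]
        by (auto simp: nontrivial_def)
    next
      case False
      then have "dif C b \<in> essential C B" using b by (auto simp: nontrivial_def)
      then have "\<sigma> (dif C b) \<in> essential D A" "?\<phi> (dif C b) = \<sigma> (dif C b)" using \<sigma>E \<phi>E by auto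
      then show ?thesis using top[OF b False] by (auto simp: nontrivial_def)
    qed
    then show "?\<phi> b \<in> nontrivial D A" "dif D (?\<phi> b) = ?\<phi> (dif C b)"
      "b \<in> grd C i \<Longrightarrow> ?\<phi> b \<in> grd D i" "b \<in> fil C k \<Longrightarrow> ?\<phi> b \<in> fil D k" for i k by blast+
  qed
qed

lemma bar_extension_inverse:
  assumes C: "filtered_complex C" "barcode_basis C B" and D: "filtered_complex D" "barcode_basis D A"
    and \<sigma>: "\<And>t b. b \<in> bars C B t \<Longrightarrow> \<sigma> b \<in> bars D A t"
    and \<rho>: "\<And>t b. b \<in> bars D A t \<Longrightarrow> \<rho> b \<in> bars C B t"
    and inv: "\<And>b. b \<in> essential C B \<Longrightarrow> \<rho> (\<sigma> b) = b" and b: "b \<in> nontrivial C B"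
  shows "bar_extension D A C B \<rho> (bar_extension C B D A \<sigma> b) = b"
proof -
  interpret C: barcode_basis C B by fact
  interpret D: barcode_basis D A by fact
  have \<sigma>E: "\<sigma> b \<in> essential D A" if "b \<in> essential C B" for b
    using that \<sigma> unfolding bars_UN[OF C, symmetric] bars_UN[OF D, symmetric] by blast
  let ?c = "bar_extension C B D A \<sigma> b"
  show ?thesis
  proof (cases "b \<in> essential C B")
    case True
    then show ?thesis using \<sigma>E inv by (simp add: bar_extension_def)
  next
    case False
    then have e: "dif C b \<in> essential C B" using b by (auto simp: nontrivial_def)
    have c: "?c \<in> A" "dif D ?c = \<sigma> (dif C b)"
      using bar_extension_facts(2)[OF C D, of \<sigma> b, OF \<sigma> b False] by blast+
    have \<sigma>e: "\<sigma> (dif C b) \<in> essential D A" using \<sigma>E[OF e] .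
    then have "\<sigma> (dif C b) \<noteq> 0" using D.basis_nonzero by (auto simp: essential_def)
    then have c_not: "?c \<notin> essential D A" using c by (auto simp: essential_def)
    have c_nt: "?c \<in> nontrivial D A" using c \<sigma>e by (auto simp: nontrivial_def)
    have b': "bar_extension D A C B \<rho> ?c \<in> B"
        "dif C (bar_extension D A C B \<rho> ?c) = \<rho> (dif D ?c)"
      using bar_extension_facts(2)[OF D C, of \<rho> ?c, OF \<rho> c_nt c_not] by blast+
    have "\<rho> (dif D ?c) = dif C b" using inv e c(2) by simp
    moreover have "dif C b \<noteq> 0" using e C.basis_nonzero by (auto simp: essential_def)
    moreover have "b \<in> B" using b by (auto simp: nontrivial_def)
    ultimately show ?thesis using inj_onD[OF C.dif_inj, of "bar_extension D A C B \<rho> ?c" b] b' by simp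
  qed
qed

text \<open>Equal counts give a type-preserving bijection of bars, and this bijection and its inverse induce
  chain maps whose composites kill the bars of length zero and fix all others.\<close>

lemma homotopy_equivalent_if_same_survivors:
  assumes C: "filtered_complex C" "barcode_basis C B" and D: "filtered_complex D" "barcode_basis D A"
    and eq: "\<And>i q p. q \<le> p \<Longrightarrow> card (survivors C B i q p) = card (survivors D A i q p)"
  shows "filtered_homotopy_equivalent C D"
proof -
  interpret FC: filtered_complex C by fact
  interpret C: barcode_basis C B by fact
  interpret FD: filtered_complex D by fact
  interpret D: barcode_basis D A by fact
  have "card (bars C B t) = card (bars D A t)" for t
    by (rule card_bars_eq[OF C(2) D(2) FC.fil_Union FD.fil_Union eq])
  then have "\<exists>\<sigma>. bij_betw \<sigma> (\<Union>t. bars C B t) (\<Union>t. bars D A t) \<and>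
      (\<forall>t. \<forall>b\<in>bars C B t. \<sigma> b \<in> bars D A t)"
    by (intro bij_betw_of_equal_fibres C.finite_bars D.finite_bars bars_disjoint[OF C] bars_disjoint[OF D])
  then obtain \<sigma> where bij: "bij_betw \<sigma> (\<Union>t. bars C B t) (\<Union>t. bars D A t)"
    and \<sigma>: "\<And>t b. b \<in> bars C B t \<Longrightarrow> \<sigma> b \<in> bars D A t"
    by blast
  define \<rho> where "\<rho> = inv_into (\<Union>t. bars C B t) \<sigma>"
  have \<rho>\<sigma>: "\<rho> (\<sigma> b) = b" if "b \<in> essential C B" for b
    using that bij bij_betw_inv_into_left unfolding \<rho>_def bars_UN[OF C, symmetric] by fastforce
  have \<sigma>\<rho>: "\<sigma> (\<rho> b) = b" if "b \<in> essential D A" for b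
    using that bij bij_betw_inv_into_right unfolding \<rho>_def bars_UN[OF D, symmetric] by fastforce
  have \<rho>: "\<rho> y \<in> bars C B t" if y: "y \<in> bars D A t" for y t
  proof -
    have "y \<in> (\<Union>t. bars D A t)" using y by blast
    then obtain b where b: "b \<in> (\<Union>t. bars C B t)" "\<sigma> b = y"
      using bij unfolding bij_betw_def by (metis imageE)
    then obtain t' where t': "b \<in> bars C B t'" by blast
    then have "t' = t" using \<sigma> b(2) y bars_disjoint[OF D] by blast
    moreover have "\<rho> y = b" using \<rho>\<sigma> b unfolding bars_UN[OF C] by blast
    ultimately show ?thesis using t' by simp
  qed
  let ?\<phi> = "bar_extension C B D A \<sigma>" and ?\<psi> = "bar_extension D A C B \<rho>"
  have \<phi>: "bar_map C B D A ?\<phi>" by (rule bar_extension_facts(1)[OF C D \<sigma>])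
  have \<psi>: "bar_map D A C B ?\<psi>" by (rule bar_extension_facts(1)[OF D C \<rho>])
  obtain f where f: "Vector_Spaces.linear (scl C) (scl D) f" "\<And>b. b \<in> B \<Longrightarrow> f b = ?\<phi> b"
    "filtered_chain_map C D f" using bar_map_chain_map[OF C D \<phi>] by blast
  obtain g where g: "Vector_Spaces.linear (scl D) (scl C) g" "\<And>b. b \<in> A \<Longrightarrow> g b = ?\<psi> b"
    "filtered_chain_map D C g" using bar_map_chain_map[OF D C \<psi>] by blast
  have ntC: "nontrivial C B \<subseteq> B" and ntD: "nontrivial D A \<subseteq> A" by (auto simp: nontrivial_def)
  interpret CD: vector_space_pair "scl C" "scl D" ..
  interpret DC: vector_space_pair "scl D" "scl C" ..
  have "g (f b) = (if b \<in> nontrivial C B then b else 0)" if b: "b \<in> B" for b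
  proof (cases "b \<in> nontrivial C B")
    case True
    then have "?\<phi> b \<in> A" using \<phi> ntD unfolding bar_map_def by blast
    then show ?thesis
      using True f(2)[OF b] g(2) bar_extension_inverse[OF C D \<sigma> \<rho> \<rho>\<sigma> True] by simp
  next
    case False
    then have "?\<phi> b = 0" using \<phi> unfolding bar_map_def by blast
    then show ?thesis using False f(2)[OF b] DC.linear_0[OF g(1)] by simp
  qed
  then have "filtered_homotopic C C (g \<circ> f) id"
    by (rule bar_maps_homotopic_id[OF C FD.vector_space_axioms f(1) g(1)])
  moreover have "f (g b) = (if b \<in> nontrivial D A then b else 0)" if b: "b \<in> A" for b
  proof (cases "b \<in> nontrivial D A")
    case True
    then have "?\<psi> b \<in> B" using \<psi> ntC unfolding bar_map_def by blast
    then show ?thesis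
      using True g(2)[OF b] f(2) bar_extension_inverse[OF D C \<rho> \<sigma> \<sigma>\<rho> True] by simp
  next
    case False
    then have "?\<psi> b = 0" using \<psi> unfolding bar_map_def by blast
    then show ?thesis using False g(2)[OF b] CD.linear_0[OF f(1)] by simp
  qed
  then have "filtered_homotopic D D (f \<circ> g) id"
    by (rule bar_maps_homotopic_id[OF D FC.vector_space_axioms g(1) f(1)])
  ultimately show ?thesis unfolding filtered_homotopy_equivalent_def using f(3) g(3) by blast
qed

section \<open>Graded planes and shifted sums\<close>

text \<open>A common form of the homology of the circle (\<open>s = 1\<close>) and of the two-point space (\<open>s = 0\<close>): two
  generators, in degrees \<open>s\<close> and \<open>0\<close>.\<close>

definition plane :: "int \<Rightarrow> ('k::field, 'k \<times> 'k) filt_complex" where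
  "plane s =
     \<lparr>scl = (\<lambda>c (a, b). (c * a, c * b)),
      carr = UNIV,
      grd = (\<lambda>i. {(a, b). (a \<noteq> 0 \<longrightarrow> i = s) \<and> (b \<noteq> 0 \<longrightarrow> i = 0)}),
      fil = (\<lambda>k. if k < 0 then {0} else UNIV),
      dif = (\<lambda>_. 0)\<rparr>"

lemma H_S1_eq_plane: "H_S1 = plane 1"
  by (auto simp: H_S1_def plane_def zero_prod_def fun_eq_iff split: if_splits)

lemma H_S0_eq_plane: "H_S0 = plane 0"
  by (auto simp: H_S0_def plane_def zero_prod_def fun_eq_iff split: if_splits)

text \<open>The complex \<open>C[s] \<oplus> C\<close>.\<close>

definition shift_sum ::
    "int \<Rightarrow> ('k::field, 'a::ab_group_add) filt_complex \<Rightarrow> ('k, 'a \<times> 'a) filt_complex" where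
  "shift_sum s C =
     \<lparr>scl = (\<lambda>c (x, y). (scl C c x, scl C c y)),
      carr = carr C \<times> carr C,
      grd = (\<lambda>n. grd C (n - s) \<times> grd C n),
      fil = (\<lambda>k. fil C k \<times> fil C k),
      dif = map_prod (dif C) (dif C)\<rparr>"

lemma vector_space_prod_scale:
  assumes "vector_space s"
  shows "vector_space (\<lambda>c (x, y). (s c x, s c y))"
proof -
  interpret vector_space s by fact
  show ?thesis by unfold_locales (auto simp: scale_right_distrib scale_left_distrib)
qed

section \<open>Transport of homotopy equivalences along isomorphisms\<close>

text \<open>The properties of a complex that make composites of filtered maps well behaved on carriers.\<close>

definition exhaustive :: "('k::field, 'a::ab_group_add) filt_complex \<Rightarrow> bool" where
  "exhaustive C \<longleftrightarrow> vector_space (scl C) \<and> module.subspace (scl C) (carr C) \<and>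
     (\<Union>k. fil C k) = carr C \<and> dif C ` carr C \<subseteq> carr C"

lemma linear_on_comp:
  assumes f: "linear_on S s1 s2 f" "\<And>x. x \<in> S \<Longrightarrow> f x \<in> T" and g: "linear_on T s2 s3 g"
  shows "linear_on S s1 s3 (g \<circ> f)"
  using assms unfolding linear_on_def by simp

lemma filtered_chain_map_carr:
  assumes "exhaustive C" "exhaustive D" "filtered_chain_map C D f" "x \<in> carr C"
  shows "f x \<in> carr D"
proof -
  obtain k where "x \<in> fil C k" using assms(1,4) unfolding exhaustive_def by blast
  then have "f x \<in> fil D k" by (rule filtered_chain_mapD(3)[OF assms(3)])
  then show ?thesis using assms(2) unfolding exhaustive_def by blast
qed

lemma filtered_chain_map_comp:
  assumes "exhaustive C" "exhaustive D" and f: "filtered_chain_map C D f" and g: "filtered_chain_map D E g"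
  shows "filtered_chain_map C E (g \<circ> f)"
  using filtered_chain_mapD[OF f] filtered_chain_mapD[OF g] filtered_chain_map_carr[OF assms(1-3)]
  unfolding filtered_chain_map_def linear_on_def by auto

text \<open>A homotopy \<open>h\<close> is carried to \<open>\<psi> \<circ> h \<circ> \<phi>\<close>. The map \<open>e\<close>, the identity on \<open>carr D\<close>, stands for the
  composite of an isomorphism with its inverse that arises in the middle when \<open>f\<close> and \<open>g\<close> are conjugated
  separately.\<close>

lemma homotopic_id_transport:
  assumes E: "exhaustive E" and C: "exhaustive C" and D: "exhaustive D"
    and \<phi>: "filtered_chain_map E C \<phi>" and \<psi>: "filtered_chain_map C E \<psi>"
    and inv: "\<And>x. x \<in> carr E \<Longrightarrow> \<psi> (\<phi> x) = x"
    and f: "filtered_chain_map C D f" and g: "filtered_chain_map D C g"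
    and e: "\<And>y. y \<in> carr D \<Longrightarrow> e y = y"
    and h: "filtered_homotopic C C (g \<circ> f) id"
  shows "filtered_homotopic E E (\<psi> \<circ> g \<circ> e \<circ> f \<circ> \<phi>) id"
proof -
  obtain h where h': "linear_on (carr C) (scl C) (scl C) h \<and> (\<forall>i. h ` grd C i \<subseteq> grd C (i + 1)) \<and>
      (\<forall>k. h ` fil C k \<subseteq> fil C k) \<and> (\<forall>x\<in>carr C. (g \<circ> f) x - id x = dif C (h x) + h (dif C x))"
    using h unfolding filtered_homotopic_def ..
  then have lin: "linear_on (carr C) (scl C) (scl C) h" by blast
  have grd: "\<And>i x. x \<in> grd C i \<Longrightarrow> h x \<in> grd C (i + 1)" using h' by blast
  have fil: "\<And>k x. x \<in> fil C k \<Longrightarrow> h x \<in> fil C k" using h' by blast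
  have eq: "\<And>x. x \<in> carr C \<Longrightarrow> g (f x) - x = dif C (h x) + h (dif C x)" using h' by simp
  note \<phi>' = filtered_chain_mapD[OF \<phi>] and \<psi>' = filtered_chain_mapD[OF \<psi>]
  have \<phi>c: "\<phi> x \<in> carr C" if "x \<in> carr E" for x
    using filtered_chain_map_carr[OF E C \<phi> that] .
  have fc: "f x \<in> carr D" if "x \<in> carr C" for x
    using filtered_chain_map_carr[OF C D f that] .
  have gc: "g x \<in> carr C" if "x \<in> carr D" for x
    using filtered_chain_map_carr[OF D C g that] .
  have hc: "h x \<in> carr C" if "x \<in> carr C" for x
  proof -
    have carr: "(\<Union>k. fil C k) = carr C" using C unfolding exhaustive_def by blast
    then have "x \<in> (\<Union>k. fil C k)" using that by simp
    then obtain k where "x \<in> fil C k" by (rule UN_E)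
    then have "h x \<in> fil C k" by (rule fil)
    then show ?thesis using carr by blast
  qed
  have dc: "dif C x \<in> carr C" if "x \<in> carr C" for x
    using that C unfolding exhaustive_def by blast
  have "(\<psi> \<circ> g \<circ> e \<circ> f \<circ> \<phi>) x - id x = dif E ((\<psi> \<circ> h \<circ> \<phi>) x) + (\<psi> \<circ> h \<circ> \<phi>) (dif E x)"
    if x: "x \<in> carr E" for x
  proof -
    let ?y = "\<phi> x"
    have y: "?y \<in> carr C" by (rule \<phi>c[OF x])
    have "\<psi> (g (f ?y)) - x = \<psi> (g (f ?y)) - \<psi> ?y" using inv[OF x] by simp
    also have "\<dots> = \<psi> (g (f ?y) - ?y)"
      by (rule linear_on_diff[symmetric, OF _ _ _ \<psi>'(1)])
         (use C E y fc gc in \<open>auto simp: exhaustive_def\<close>)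
    also have "\<dots> = \<psi> (dif C (h ?y)) + \<psi> (h (dif C ?y))"
      using eq[OF y] \<psi>'(1) y hc dc unfolding linear_on_def by simp
    also have "\<dots> = dif E (\<psi> (h ?y)) + \<psi> (h (\<phi> (dif E x)))"
      using \<psi>'(4)[OF hc[OF y]] \<phi>'(4)[OF x] by simp
    finally show ?thesis using e[OF fc[OF y]] by simp
  qed
  moreover have "linear_on (carr E) (scl E) (scl E) (\<psi> \<circ> h \<circ> \<phi>)"
    using \<phi>'(1) \<psi>'(1) lin \<phi>c hc unfolding linear_on_def by auto
  moreover have "(\<psi> \<circ> h \<circ> \<phi>) ` grd E i \<subseteq> grd E (i + 1)" "(\<psi> \<circ> h \<circ> \<phi>) ` fil E k \<subseteq> fil E k" for i k
    using \<phi>'(2,3) \<psi>'(2,3) grd fil by auto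
  ultimately show ?thesis unfolding filtered_homotopic_def by blast
qed

definition filtered_isomorphism ::
    "('k::field, 'a::ab_group_add) filt_complex \<Rightarrow> ('k, 'b::ab_group_add) filt_complex \<Rightarrow>
      ('a \<Rightarrow> 'b) \<Rightarrow> ('b \<Rightarrow> 'a) \<Rightarrow> bool" where
  "filtered_isomorphism C D \<phi> \<psi> \<longleftrightarrow> filtered_chain_map C D \<phi> \<and> filtered_chain_map D C \<psi> \<and>
     (\<forall>x\<in>carr C. \<psi> (\<phi> x) = x) \<and> (\<forall>y\<in>carr D. \<phi> (\<psi> y) = y)"

lemma homotopy_equivalent_transport:
  assumes ex: "exhaustive C" "exhaustive C'" "exhaustive D" "exhaustive D'"
    and \<phi>: "filtered_isomorphism C C' \<phi> \<phi>'" and \<psi>: "filtered_isomorphism D D' \<psi> \<psi>'"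
    and eqv: "filtered_homotopy_equivalent C' D'"
  shows "filtered_homotopy_equivalent C D"
proof -
  obtain f g where f: "filtered_chain_map C' D' f" and g: "filtered_chain_map D' C' g"
    and h: "filtered_homotopic C' C' (g \<circ> f) id" "filtered_homotopic D' D' (f \<circ> g) id"
    using eqv unfolding filtered_homotopy_equivalent_def by blast
  have \<phi>1: "filtered_chain_map C C' \<phi>" and \<phi>2: "filtered_chain_map C' C \<phi>'"
    and \<phi>i: "\<And>x. x \<in> carr C \<Longrightarrow> \<phi>' (\<phi> x) = x" "\<And>y. y \<in> carr C' \<Longrightarrow> (\<phi> \<circ> \<phi>') y = y"
    using \<phi> by (simp_all add: filtered_isomorphism_def)
  have \<psi>1: "filtered_chain_map D D' \<psi>" and \<psi>2: "filtered_chain_map D' D \<psi>'"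
    and \<psi>i: "\<And>x. x \<in> carr D \<Longrightarrow> \<psi>' (\<psi> x) = x" "\<And>y. y \<in> carr D' \<Longrightarrow> (\<psi> \<circ> \<psi>') y = y"
    using \<psi> by (simp_all add: filtered_isomorphism_def)
  let ?f = "\<psi>' \<circ> (f \<circ> \<phi>)" and ?g = "\<phi>' \<circ> (g \<circ> \<psi>)"
  have "filtered_homotopic C C (\<phi>' \<circ> g \<circ> (\<psi> \<circ> \<psi>') \<circ> f \<circ> \<phi>) id"
    by (rule homotopic_id_transport[OF ex(1,2,4) \<phi>1 \<phi>2 \<phi>i(1) f g \<psi>i(2) h(1)])
  then have "filtered_homotopic C C (?g \<circ> ?f) id" by (simp add: comp_assoc)
  moreover have "filtered_homotopic D D (\<psi>' \<circ> f \<circ> (\<phi> \<circ> \<phi>') \<circ> g \<circ> \<psi>) id"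
    by (rule homotopic_id_transport[OF ex(3,4,2) \<psi>1 \<psi>2 \<psi>i(1) g f \<phi>i(2) h(2)])
  then have "filtered_homotopic D D (?f \<circ> ?g) id" by (simp add: comp_assoc)
  moreover have "filtered_chain_map C D ?f"
    by (rule filtered_chain_map_comp[OF ex(1,4) filtered_chain_map_comp[OF ex(1,2) \<phi>1 f] \<psi>2])
  moreover have "filtered_chain_map D C ?g"
    by (rule filtered_chain_map_comp[OF ex(3,2) filtered_chain_map_comp[OF ex(3,4) \<psi>1 g] \<phi>2])
  ultimately show ?thesis unfolding filtered_homotopy_equivalent_def by blast
qed

section \<open>The tensor product as a shifted sum\<close>

lemma exhaustive_shift_sum:
  assumes "filtered_complex C"
  shows "exhaustive (shift_sum s C)"
proof -
  interpret filtered_complex C by fact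
  have vs: "vector_space (\<lambda>c (x, y). (scl C c x, scl C c y))"
    by (rule vector_space_prod_scale) (rule vector_space_axioms)
  have "\<exists>k. x \<in> fil C k \<and> y \<in> fil C k" if xy: "x \<in> carr C" "y \<in> carr C" for x y
  proof -
    obtain j k where "x \<in> fil C j" "y \<in> fil C k" using xy fil_Union by blast
    then have "x \<in> fil C (max j k)" "y \<in> fil C (max j k)"
      using fil_mono[of j "max j k"] fil_mono[of k "max j k"] by auto
    then show ?thesis by blast
  qed
  then have "carr C \<times> carr C \<subseteq> (\<Union>k. fil C k \<times> fil C k)" by (simp add: subset_iff)
  moreover have "fil C k \<times> fil C k \<subseteq> carr C \<times> carr C" for k
    using fil_subset[of k] by (intro Sigma_mono)
  ultimately have "(\<Union>k. fil C k \<times> fil C k) = carr C \<times> carr C" by (intro equalityI UN_least)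
  moreover have "module.subspace (\<lambda>c (x, y). (scl C c x, scl C c y)) (carr C \<times> carr C)"
    unfolding module.subspace_def[OF vs[folded module_iff_vector_space]]
    using subspace_carr by (auto simp: subspace_def zero_prod_def)
  ultimately show ?thesis
    using vs dif_carr unfolding exhaustive_def shift_sum_def by auto
qed

text \<open>The isomorphism sends \<open>(x, y)\<close> to \<open>x \<otimes> (1, 0) + y \<otimes> (0, 1)\<close>; its inverse comes from the
  universal property. As the differential of the plane is zero, no signs arise in the tensor differential,
  and that differential is identified through its uniqueness with the one carried over from \<open>C[s] \<oplus> C\<close>.\<close>

lemma tensor_plane:
  fixes C :: "('k::field, 'a::ab_group_add) filt_complex"
  assumes "filtered_complex C"
  obtains \<phi> \<psi> where "filtered_isomorphism (shift_sum s C) (tensor C (plane s)) \<phi> \<psi>"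
    "exhaustive (tensor C (plane s))"
proof -
  interpret filtered_complex C by fact
  let ?X = "plane s :: ('k, 'k \<times> 'k) filt_complex"
  let ?t = "pure_tensor C ?X"
  let ?T = "tensor_carr C ?X"
  let ?e1 = "(1, 0) :: 'k \<times> 'k" and ?e2 = "(0, 1) :: 'k \<times> 'k"
  let ?E = "shift_sum s C"
  let ?ps = "\<lambda>c (x, y). (scl C c x, scl C c y)"
  have vs: "vector_space ?ps" by (rule vector_space_prod_scale) (rule vector_space_axioms)
  have carrX: "carr ?X = UNIV" and sclX: "scl ?X = (\<lambda>c (a, b). (c * a, c * b))"
    and difX: "dif ?X = (\<lambda>_. 0)"
    and grdX: "grd ?X = (\<lambda>i. {(a, b). (a \<noteq> 0 \<longrightarrow> i = s) \<and> (b \<noteq> 0 \<longrightarrow> i = 0)})"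
    and filX: "fil ?X = (\<lambda>k. if k < 0 then {0} else UNIV)" by (simp_all add: plane_def)
  note bl = bilinear_pure_tensor[of C ?X, unfolded bilinear_on_def linear_on_def carrX]
  have t_add1: "?t (x + x') v = ?t x v + ?t x' v" if "x \<in> carr C" "x' \<in> carr C" for x x' v
    using bl that by blast
  have t_scl1: "?t (scl C c x) v = tensor_scl c (?t x v)" if "x \<in> carr C" for c x v
    using bl that by blast
  have t_add2: "?t x (v + v') = ?t x v + ?t x v'" if "x \<in> carr C" for x v v'
    using bl that by blast
  have t_scl2: "?t x (scl ?X c v) = tensor_scl c (?t x v)" if "x \<in> carr C" for c x v
    using bl that by blast
  have tT: "?t x v \<in> ?T" if "x \<in> carr C" for x v
    using pure_tensor_in_tensor_carr[OF that] carrX by blast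
  have T_sub: "tensor_space.subspace ?T" unfolding tensor_carr_def by simp
  define \<phi> where "\<phi> = (\<lambda>(x, y). ?t x ?e1 + ?t y ?e2)"
  have \<phi>_scaled: "\<phi> (scl C a x, scl C b x) = ?t x (a, b)" if x: "x \<in> carr C" for a b x
  proof -
    have "(a, b) = scl ?X a ?e1 + scl ?X b ?e2" by (simp add: sclX)
    then have "?t x (a, b) = tensor_scl a (?t x ?e1) + tensor_scl b (?t x ?e2)"
      using t_add2[OF x] t_scl2[OF x] by metis
    then show ?thesis using t_scl1[OF x] by (simp add: \<phi>_def)
  qed
  have \<phi>T: "\<phi> p \<in> ?T" if "p \<in> carr C \<times> carr C" for p
    using that tT tensor_space.subspace_add[OF T_sub] by (auto simp: \<phi>_def)
  have \<phi>_lin: "linear_on (carr C \<times> carr C) ?ps tensor_scl \<phi>"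
    unfolding linear_on_def
    by (auto simp: \<phi>_def t_add1 t_scl1 tensor_space.scale_right_distrib add_ac)
  have "bilinear_on C ?X ?ps (\<lambda>x (a, b). (scl C a x, scl C b x))"
    unfolding bilinear_on_def linear_on_def
    by (auto simp: sclX scale_right_distrib scale_left_distrib mult.commute)
  from tensor_universal[OF vs this] obtain \<psi> where \<psi>_lin: "linear_on ?T tensor_scl ?ps \<psi>"
    and \<psi>_pure: "\<And>x a b. x \<in> carr C \<Longrightarrow> \<psi> (?t x (a, b)) = (scl C a x, scl C b x)"
    using carrX by auto
  note vsT = vector_space_tensor_scl
  have \<psi>\<phi>: "\<psi> (\<phi> p) = p" if p: "p \<in> carr C \<times> carr C" for p
  proof -
    obtain x y where xy: "p = (x, y)" "x \<in> carr C" "y \<in> carr C" using p by blast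
    have "\<psi> (\<phi> p) = \<psi> (?t x ?e1) + \<psi> (?t y ?e2)"
      using \<psi>_lin tT xy unfolding linear_on_def by (simp add: \<phi>_def)
    then show ?thesis using \<psi>_pure xy by simp
  qed
  have \<psi>_carr: "\<psi> t \<in> carr C \<times> carr C" and \<phi>\<psi>: "\<phi> (\<psi> t) = t" if t: "t \<in> ?T" for t
  proof -
    have "\<psi> t \<in> carr C \<times> carr C \<and> \<phi> (\<psi> t) = t"
      using t unfolding tensor_carr_def
    proof (induction rule: tensor_space.span_induct_alt)
      case base
      have "\<psi> 0 = 0" by (rule linear_on_zero[OF vsT vs _ \<psi>_lin]) (rule tensor_space.subspace_0[OF T_sub])
      moreover have "\<phi> 0 = 0"
        by (rule linear_on_zero[OF vs vsT _ \<phi>_lin]) (simp add: zero_prod_def subspace_0[OF subspace_carr])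
      moreover have "0 \<in> carr C \<times> carr C" by (simp add: zero_prod_def subspace_0[OF subspace_carr])
      ultimately show ?case by (simp only: simp_thms)
    next
      case (step c u v)
      obtain x a b where u: "u = ?t x (a, b)" "x \<in> carr C" using step(1) by auto
      have v: "v \<in> ?T" using \<phi>T step(2) by metis
      have cu: "tensor_scl c u \<in> ?T" using tensor_space.subspace_scale[OF T_sub] tT u by blast
      have 1: "\<psi> (tensor_scl c u + v) = ?ps c (\<psi> u) + \<psi> v"
        using \<psi>_lin cu v tT u unfolding linear_on_def by metis
      have \<psi>u: "\<psi> u \<in> carr C \<times> carr C" "\<phi> (\<psi> u) = u"
        using u \<psi>_pure \<phi>_scaled subspace_scale[OF subspace_carr] by auto
      then have c\<psi>u: "?ps c (\<psi> u) \<in> carr C \<times> carr C"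
        using subspace_scale[OF subspace_carr] by auto
      have "?ps c (\<psi> u) + \<psi> v \<in> carr C \<times> carr C"
        using c\<psi>u step(2) subspace_add[OF subspace_carr] by auto
      moreover have "\<phi> (?ps c (\<psi> u) + \<psi> v) = tensor_scl c u + v"
        using \<phi>_lin c\<psi>u \<psi>u step(2) unfolding linear_on_def by metis
      ultimately show ?case unfolding 1 by (simp only: simp_thms)
    qed
    then show "\<psi> t \<in> carr C \<times> carr C" "\<phi> (\<psi> t) = t" by blast+
  qed
  \<comment> \<open>The differential of the shifted sum, carried over to the tensor product.\<close>
  define d where "d = \<phi> \<circ> map_prod (dif C) (dif C) \<circ> \<psi>"
  have dp: "map_prod (dif C) (dif C) p \<in> carr C \<times> carr C" if "p \<in> carr C \<times> carr C" for p
    using that dif_carr by auto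
  have "is_tensor_dif C ?X d"
    unfolding is_tensor_dif_def
  proof (intro conjI allI ballI)
    have "linear_on (carr C \<times> carr C) ?ps ?ps (map_prod (dif C) (dif C))"
      using dif_linear unfolding linear_on_def by auto
    then have \<phi>d: "linear_on (carr C \<times> carr C) ?ps tensor_scl (\<phi> \<circ> map_prod (dif C) (dif C))"
      by (rule linear_on_comp[OF _ dp \<phi>_lin])
    show "linear_on ?T tensor_scl tensor_scl d"
      unfolding d_def by (rule linear_on_comp[OF \<psi>_lin _ \<phi>d]) (rule \<psi>_carr)
    fix i x and v :: "'k \<times> 'k" assume x: "x \<in> grd C i"
    obtain a b where v: "v = (a, b)" by (cases v)
    have xc: "x \<in> carr C" using x grd_subset by blast
    have "d (?t x v) = \<phi> (dif C (scl C a x), dif C (scl C b x))"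
      using \<psi>_pure[OF xc] by (simp add: d_def v)
    also have "\<dots> = \<phi> (scl C a (dif C x), scl C b (dif C x))"
      using dif_linear xc unfolding linear_on_def by simp
    also have "\<dots> = ?t (dif C x) v" using \<phi>_scaled[OF dif_carr[OF xc]] v by simp
    finally have 1: "d (?t x v) = ?t (dif C x) v" .
    have "scl ?X 0 0 = 0" by (simp add: sclX zero_prod_def)
    then have "?t x 0 = 0" using t_scl2[OF xc, of 0 0] by simp
    then show "d (?t x v) = ?t (dif C x) v + tensor_scl ((- 1) powi i) (?t x (dif ?X v))"
      using 1 by (simp add: difX del: zero_fun_apply)
  qed
  then have "is_tensor_dif C ?X (dif (tensor C ?X))"
    using someI[of "is_tensor_dif C ?X" d] by (simp add: tensor_def)
  then have difT: "dif (tensor C ?X) t = d t" if "t \<in> ?T" for t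
    using tensor_dif_unique[OF assms _ \<open>is_tensor_dif C ?X d\<close> that] by blast
  have sel: "scl ?E = ?ps" "carr ?E = carr C \<times> carr C" "grd ?E n = grd C (n - s) \<times> grd C n"
    "fil ?E n = fil C n \<times> fil C n" "dif ?E = map_prod (dif C) (dif C)"
    "scl (tensor C ?X) = tensor_scl" "carr (tensor C ?X) = ?T" for n
    by (simp_all add: shift_sum_def tensor_def)
  let ?G = "\<lambda>n. {?t x v | x v i j. i + j = n \<and> x \<in> grd C i \<and> v \<in> grd ?X j}"
  let ?F = "\<lambda>n. {?t x v | x v p q. p + q = n \<and> x \<in> fil C p \<and> v \<in> fil ?X q}"
  have gT: "grd (tensor C ?X) n = tensor_space.span (?G n)"
    and fT: "fil (tensor C ?X) n = tensor_space.span (?F n)" for n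
    by (simp_all add: tensor_def)
  have e: "?e1 \<in> grd ?X s" "?e2 \<in> grd ?X 0" "?e1 \<in> fil ?X 0" "?e2 \<in> fil ?X 0"
    by (auto simp: grdX filX)
  have \<phi>_grd: "\<phi> p \<in> grd (tensor C ?X) n" if p: "p \<in> grd ?E n" for p n
  proof -
    obtain x y where xy: "p = (x, y)" "x \<in> grd C (n - s)" "y \<in> grd C n" using p sel(3) by blast
    have "(n - s) + s = n" "n + 0 = n" by simp_all
    then have "?t x ?e1 \<in> ?G n" "?t y ?e2 \<in> ?G n" using xy e by blast+
    then show ?thesis unfolding gT \<phi>_def xy(1) prod.case
      by (intro tensor_space.span_add tensor_space.span_base)
  qed
  have \<phi>_fil: "\<phi> p \<in> fil (tensor C ?X) n" if p: "p \<in> fil ?E n" for p n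
  proof -
    obtain x y where xy: "p = (x, y)" "x \<in> fil C n" "y \<in> fil C n" using p sel(4) by blast
    have "n + 0 = n" by simp
    then have "?t x ?e1 \<in> ?F n" "?t y ?e2 \<in> ?F n" using xy e by blast+
    then show ?thesis unfolding fT \<phi>_def xy(1) prod.case
      by (intro tensor_space.span_add tensor_space.span_base)
  qed
  interpret VP: vector_space_pair "tensor_scl :: 'k \<Rightarrow> _ \<Rightarrow> (('a \<Rightarrow> 'k \<times> 'k \<Rightarrow> 'k) \<Rightarrow> 'k)" ?ps
    using vsT vs by (simp add: vector_space_pair_def)
  obtain L where L: "Vector_Spaces.linear tensor_scl ?ps L" "\<forall>t\<in>?T. L t = \<psi> t"
    using VP.linear_on_extend[OF T_sub \<psi>_lin] by blast
  have \<psi>_span: "\<psi> t \<in> U \<times> V"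
    if U: "subspace U" "subspace V" and G: "G \<subseteq> ?T" "\<psi> ` G \<subseteq> U \<times> V" and t: "t \<in> tensor_space.span G"
    for G U V t
  proof -
    have "VP.vs2.subspace (U \<times> V)"
      using U unfolding VP.vs2.subspace_def by (auto simp: subspace_def zero_prod_def)
    moreover have "L ` G \<subseteq> U \<times> V" using L(2) G by (auto simp: subset_iff image_subset_iff)
    ultimately have "L t \<in> U \<times> V" using VP.linear_image_span_subset[OF L(1)] t by blast
    moreover have "t \<in> ?T" using t tensor_space.span_minimal[OF G(1) T_sub] by blast
    ultimately show ?thesis using L(2) by simp
  qed
  have GT: "?G n \<subseteq> ?T" and FT: "?F n \<subseteq> ?T" for n
    using tT grd_subset fil_subset by blast+
  have \<psi>_grd: "\<psi> t \<in> grd ?E n" if t: "t \<in> grd (tensor C ?X) n" for t n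
    unfolding sel
  proof (rule \<psi>_span[OF subspace_grd subspace_grd GT _ t[unfolded gT]])
    show "\<psi> ` ?G n \<subseteq> grd C (n - s) \<times> grd C n"
    proof
      fix p assume "p \<in> \<psi> ` ?G n"
      then obtain x v i j where g: "p = \<psi> (?t x v)" "i + j = n" "x \<in> grd C i" "v \<in> grd ?X j" by blast
      obtain a b where v: "v = (a, b)" by (cases v)
      have "p = (scl C a x, scl C b x)" using g(1,3) v \<psi>_pure[of x] grd_subset[of i] by auto
      moreover have "scl C a x \<in> grd C (n - s)"
      proof (cases "a = 0")
        case False
        then have "i = n - s" using g(2,4) v by (auto simp: grdX)
        then show ?thesis using g(3) subspace_scale[OF subspace_grd] by blast
      qed (simp add: subspace_0[OF subspace_grd])
      moreover have "scl C b x \<in> grd C n"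
      proof (cases "b = 0")
        case False
        then have "i = n" using g(2,4) v by (auto simp: grdX)
        then show ?thesis using g(3) subspace_scale[OF subspace_grd] by blast
      qed (simp add: subspace_0[OF subspace_grd])
      ultimately show "p \<in> grd C (n - s) \<times> grd C n" by simp
    qed
  qed
  have \<psi>_fil: "\<psi> t \<in> fil ?E n" if t: "t \<in> fil (tensor C ?X) n" for t n
    unfolding sel
  proof (rule \<psi>_span[OF subspace_fil subspace_fil FT _ t[unfolded fT]])
    show "\<psi> ` ?F n \<subseteq> fil C n \<times> fil C n"
    proof
      fix y assume "y \<in> \<psi> ` ?F n"
      then obtain x v p q where g: "y = \<psi> (?t x v)" "p + q = n" "x \<in> fil C p" "v \<in> fil ?X q" by blast
      obtain a b where v: "v = (a, b)" by (cases v)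
      have y: "y = (scl C a x, scl C b x)" using g(1,3) v \<psi>_pure[of x] fil_subset[of p] by auto
      show "y \<in> fil C n \<times> fil C n"
      proof (cases "q < 0")
        case True
        then have "a = 0" "b = 0" using g(4) v by (auto simp: filX zero_prod_def)
        then show ?thesis using y subspace_0[OF subspace_fil] by simp
      next
        case False
        then have "x \<in> fil C n" using g(2,3) fil_mono[of p n] by auto
        then show ?thesis using y subspace_scale[OF subspace_fil] by simp
      qed
    qed
  qed
  have "filtered_isomorphism ?E (tensor C ?X) \<phi> \<psi>"
    unfolding filtered_isomorphism_def filtered_chain_map_def
  proof (intro conjI allI ballI)
    show "linear_on (carr ?E) (scl ?E) (scl (tensor C ?X)) \<phi>"
      "linear_on (carr (tensor C ?X)) (scl (tensor C ?X)) (scl ?E) \<psi>"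
      unfolding sel by (fact \<phi>_lin, fact \<psi>_lin)
    show "\<phi> ` grd ?E i \<subseteq> grd (tensor C ?X) i" "\<psi> ` grd (tensor C ?X) i \<subseteq> grd ?E i" for i
      using \<phi>_grd \<psi>_grd by blast+
    show "\<phi> ` fil ?E k \<subseteq> fil (tensor C ?X) k" "\<psi> ` fil (tensor C ?X) k \<subseteq> fil ?E k" for k
      using \<phi>_fil \<psi>_fil by blast+
    show "\<psi> (\<phi> p) = p" if "p \<in> carr ?E" for p using \<psi>\<phi> that sel by simp
    show "\<phi> (\<psi> t) = t" if "t \<in> carr (tensor C ?X)" for t using \<phi>\<psi> that sel by simp
    show "\<phi> (dif ?E p) = dif (tensor C ?X) (\<phi> p)" if "p \<in> carr ?E" for p
      using that difT[OF \<phi>T, of p] \<psi>\<phi>[of p] unfolding sel by (simp add: d_def)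
    show "\<psi> (dif (tensor C ?X) t) = dif ?E (\<psi> t)" if "t \<in> carr (tensor C ?X)" for t
      using that difT[of t] \<psi>\<phi>[OF dp[OF \<psi>_carr]] unfolding sel by (simp add: d_def)
  qed
  moreover have "exhaustive (tensor C ?X)"
    unfolding exhaustive_def sel
  proof (intro conjI)
    show "(\<Union>k. fil (tensor C ?X) k) = ?T"
    proof
      show "(\<Union>k. fil (tensor C ?X) k) \<subseteq> ?T"
        unfolding fT using tensor_space.span_minimal[OF FT T_sub] by blast
      show "?T \<subseteq> (\<Union>k. fil (tensor C ?X) k)"
      proof
        fix t assume t: "t \<in> ?T"
        have "\<psi> t \<in> carr ?E" using \<psi>_carr[OF t] sel by simp
        then obtain k where "\<psi> t \<in> fil ?E k"
          using exhaustive_shift_sum[OF assms, of s] unfolding exhaustive_def by blast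
        then have "t \<in> fil (tensor C ?X) k" using \<phi>_fil[of "\<psi> t" k] \<phi>\<psi>[OF t] by simp
        then show "t \<in> (\<Union>k. fil (tensor C ?X) k)" by blast
      qed
    qed
    show "dif (tensor C ?X) ` ?T \<subseteq> ?T"
      using difT \<phi>T[OF dp[OF \<psi>_carr]] by (auto simp: d_def)
  qed (fact vsT T_sub)+
  ultimately show ?thesis using that by blast
qed

section \<open>Barcodes of shifted sums\<close>

definition doubled_basis :: "'a::zero set \<Rightarrow> ('a \<times> 'a) set" where
  "doubled_basis B = (\<lambda>b. (b, 0)) ` B \<union> (\<lambda>b. (0, b)) ` B"

lemma span_doubled:
  fixes s :: "'k::field \<Rightarrow> 'a::ab_group_add \<Rightarrow> 'a"
  assumes "vector_space s"
  shows "module.span (\<lambda>c (x, y). (s c x, s c y)) ((\<lambda>b. (b, 0)) ` S \<union> (\<lambda>b. (0, b)) ` T)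
    = module.span s S \<times> module.span s T"
proof -
  let ?ps = "\<lambda>c (x, y). (s c x, s c y)"
  interpret V: vector_space s by fact
  interpret P: vector_space ?ps by (rule vector_space_prod_scale) fact
  interpret VP: vector_space_pair s ?ps ..
  have l: "Vector_Spaces.linear s ?ps (\<lambda>b. (b, 0))" "Vector_Spaces.linear s ?ps (\<lambda>b. (0, b))"
    using V.vector_space_axioms P.vector_space_axioms by (simp_all add: Vector_Spaces.linear_iff)
  show ?thesis
    unfolding P.span_Un VP.linear_span_image[OF l(1)] VP.linear_span_image[OF l(2)]
    by (fastforce simp: image_iff)
qed

lemma barcode_basis_shift_sum:
  assumes "filtered_complex C" "barcode_basis C B"
  shows "barcode_basis (shift_sum s C) (doubled_basis B)"
proof -
  interpret FC: filtered_complex C by fact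
  interpret C: barcode_basis C B by fact
  let ?ps = "\<lambda>c (x, y). (scl C c x, scl C c y)"
  interpret P: vector_space ?ps by (rule vector_space_prod_scale) (rule FC.vector_space_axioms)
  note span = span_doubled[OF FC.vector_space_axioms]
  let ?B = "doubled_basis B"
  have sel: "scl (shift_sum s C) = ?ps" "carr (shift_sum s C) = carr C \<times> carr C"
    "grd (shift_sum s C) n = grd C (n - s) \<times> grd C n"
    "fil (shift_sum s C) n = fil C n \<times> fil C n" "dif (shift_sum s C) = map_prod (dif C) (dif C)" for n
    by (simp_all add: shift_sum_def)
  have Int: "?B \<inter> U \<times> V = (\<lambda>b. (b, 0)) ` (B \<inter> U) \<union> (\<lambda>b. (0, b)) ` (B \<inter> V)"
    if "0 \<in> U" "0 \<in> V" for U V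
    using that by (auto simp: doubled_basis_def)
  have span_Int: "P.span (?B \<inter> U \<times> V) = FC.span (B \<inter> U) \<times> FC.span (B \<inter> V)"
    if "0 \<in> U" "0 \<in> V" for U V
    using Int[OF that] span by simp
  have ind: "P.independent ?B"
    unfolding P.dependent_def
  proof (rule notI, elim bexE)
    fix a assume a: "a \<in> ?B" "a \<in> P.span (?B - {a})"
    from a(1) consider b where "b \<in> B" "a = (b, 0)" | b where "b \<in> B" "a = (0, b)"
      by (auto simp: doubled_basis_def)
    then show False
    proof cases
      case 1
      have "?B - {a} \<subseteq> (\<lambda>b. (b, 0)) ` (B - {b}) \<union> (\<lambda>b. (0, b)) ` B"
        using 1 by (auto simp: doubled_basis_def)
      then have "a \<in> FC.span (B - {b}) \<times> FC.span B"
        using a(2) P.span_mono unfolding span[symmetric] by blast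
      then show False using 1 C.independent_basis by (auto simp: FC.dependent_def)
    next
      case 2
      have "?B - {a} \<subseteq> (\<lambda>b. (b, 0)) ` B \<union> (\<lambda>b. (0, b)) ` (B - {b})"
        using 2 by (auto simp: doubled_basis_def)
      then have "a \<in> FC.span B \<times> FC.span (B - {b})"
        using a(2) P.span_mono unfolding span[symmetric] by blast
      then show False using 2 C.independent_basis by (auto simp: FC.dependent_def)
    qed
  qed
  show ?thesis
  proof (intro barcode_basis.intro barcode_basis_axioms.intro, unfold sel)
    show "vector_space ?ps" by (rule P.vector_space_axioms)
    show "finite ?B" using C.finite_basis by (simp add: doubled_basis_def)
    show "P.independent ?B" by (rule ind)
    show "carr C \<times> carr C = P.span ?B" unfolding doubled_basis_def span C.carr_eq ..
    show "\<exists>i. b \<in> grd C (i - s) \<times> grd C i" if b: "b \<in> ?B" for b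
    proof -
      from b consider c where "c \<in> B" "b = (c, 0)" | c where "c \<in> B" "b = (0, c)"
        by (auto simp: doubled_basis_def)
      then show ?thesis
      proof cases
        case 1
        obtain i where "c \<in> grd C i" using C.basis_homogeneous 1(1) by blast
        then show ?thesis using 1(2) FC.subspace_0[OF FC.subspace_grd] by (intro exI[of _ "i + s"]) simp
      next
        case 2
        obtain i where "c \<in> grd C i" using C.basis_homogeneous 2(1) by blast
        then show ?thesis using 2(2) FC.subspace_0[OF FC.subspace_grd] by (intro exI[of _ i]) simp
      qed
    qed
    show "grd C (i - s) \<times> grd C i = P.span (?B \<inter> grd C (i - s) \<times> grd C i)" for i
      using FC.subspace_0[OF FC.subspace_grd] by (simp add: span_Int C.grd_eq[symmetric])
    show "fil C k \<times> fil C k = P.span (?B \<inter> fil C k \<times> fil C k)" for k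
      using FC.subspace_0[OF FC.subspace_fil] by (simp add: span_Int C.fil_eq[symmetric])
    show "fil C j \<times> fil C j \<subseteq> fil C k \<times> fil C k" if "j \<le> k" for j k
      using FC.fil_mono[OF that] by (intro Sigma_mono)
    show "linear_on (carr C \<times> carr C) ?ps ?ps (map_prod (dif C) (dif C))"
      using FC.dif_linear unfolding linear_on_def by auto
    show "map_prod (dif C) (dif C) b \<in> insert 0 ?B" if "b \<in> ?B" for b
      using that C.dif_basis FC.dif_zero by (force simp: doubled_basis_def zero_prod_def)
    show "inj_on (map_prod (dif C) (dif C)) {b \<in> ?B. map_prod (dif C) (dif C) b \<noteq> 0}"
    proof (rule inj_onI)
      have from_B: "\<exists>b\<in>B. dif C b \<noteq> 0 \<and> (u = (b, 0) \<or> u = (0, b))"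
        if "u \<in> {b \<in> ?B. map_prod (dif C) (dif C) b \<noteq> 0}" for u
        using that FC.dif_zero by (auto simp: doubled_basis_def zero_prod_def)
      fix u v assume "u \<in> {b \<in> ?B. map_prod (dif C) (dif C) b \<noteq> 0}"
        "v \<in> {b \<in> ?B. map_prod (dif C) (dif C) b \<noteq> 0}"
        and eq: "map_prod (dif C) (dif C) u = map_prod (dif C) (dif C) v"
      then obtain b c where "u = (b, 0) \<or> u = (0, b)" "v = (c, 0) \<or> v = (0, c)"
        "b \<in> B" "c \<in> B" "dif C b \<noteq> 0" "dif C c \<noteq> 0"
        using from_B by meson
      then show "u = v"
        using eq FC.dif_zero inj_onD[OF C.dif_inj, of b c] by auto
    qed
  qed
qed

text \<open>The bars of \<open>C[s] \<oplus> C\<close> are those of \<open>C\<close> together with their shifts by \<open>s\<close> in degree.\<close>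

lemma card_survivors_shift_sum:
  fixes C :: "('k::field, 'b::ab_group_add) filt_complex"
  assumes "filtered_complex C" "barcode_basis C B"
  shows "card (survivors (shift_sum s C) (doubled_basis B) i q p)
    = card (survivors C B (i - s) q p) + card (survivors C B i q p)"
proof -
  interpret FC: filtered_complex C by fact
  interpret C: barcode_basis C B by fact
  have 0: "0 \<in> grd C j" "0 \<in> fil C k" for j k
    using FC.subspace_0[OF FC.subspace_grd] FC.subspace_0[OF FC.subspace_fil] .
  have nz: "0 \<notin> B" using C.basis_nonzero by blast
  let ?D = "doubled_basis B" and ?d = "map_prod (dif C) (dif C)"
  have bound: "(b, 0) \<in> ?d ` (?D \<inter> fil C p \<times> fil C p) \<longleftrightarrow> b \<in> dif C ` (B \<inter> fil C p)"
    "(0, b) \<in> ?d ` (?D \<inter> fil C p \<times> fil C p) \<longleftrightarrow> b \<in> dif C ` (B \<inter> fil C p)" if b: "b \<in> B" for b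
  proof -
    have nb: "b \<noteq> 0" using b nz by blast
    have "(\<exists>y\<in>B \<inter> fil C p. dif C y = b)" if "(b, 0) = ?d u \<or> (0, b) = ?d u" "u \<in> ?D \<inter> fil C p \<times> fil C p" for u
      using that nb FC.dif_zero by (auto simp: doubled_basis_def)
    moreover have "(y, 0) \<in> ?D \<inter> fil C p \<times> fil C p" "(0, y) \<in> ?D \<inter> fil C p \<times> fil C p"
      if "y \<in> B \<inter> fil C p" for y using that 0 by (auto simp: doubled_basis_def)
    moreover have "?d (y, 0) = (dif C y, 0)" "?d (0, y) = (0, dif C y)" for y
      using FC.dif_zero by auto
    ultimately show "(b, 0) \<in> ?d ` (?D \<inter> fil C p \<times> fil C p) \<longleftrightarrow> b \<in> dif C ` (B \<inter> fil C p)"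
      "(0, b) \<in> ?d ` (?D \<inter> fil C p \<times> fil C p) \<longleftrightarrow> b \<in> dif C ` (B \<inter> fil C p)"
      unfolding image_iff by metis+
  qed
  let ?S = "survivors (shift_sum s C) ?D i q p"
  have mem: "(b, 0) \<in> ?S \<longleftrightarrow> b \<in> survivors C B (i - s) q p"
    "(0, b) \<in> ?S \<longleftrightarrow> b \<in> survivors C B i q p" if "b \<in> B" for b
  proof -
    have "(b, 0) \<in> ?D" "(0, b) \<in> ?D" using that by (auto simp: doubled_basis_def)
    then show "(b, 0) \<in> ?S \<longleftrightarrow> b \<in> survivors C B (i - s) q p"
      "(0, b) \<in> ?S \<longleftrightarrow> b \<in> survivors C B i q p"
      using bound[OF that] 0 FC.dif_zero that
      by (simp_all add: survivors_def shift_sum_def zero_prod_def)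
  qed
  have "?S \<subseteq> ?D" "survivors C B j q p \<subseteq> B" for j by (auto simp: survivors_def)
  then have "?S = (\<lambda>b. (b, 0)) ` survivors C B (i - s) q p \<union> (\<lambda>b. (0, b)) ` survivors C B i q p"
    using mem unfolding doubled_basis_def by blast
  then have "card ?S = card ((\<lambda>b. (b, 0::'b)) ` survivors C B (i - s) q p)
      + card ((\<lambda>b. (0::'b, b)) ` survivors C B i q p)"
    using nz by (simp only:, intro card_Un_disjoint) (auto simp: survivors_def C.finite_basis)
  also have "\<dots> = card (survivors C B (i - s) q p) + card (survivors C B i q p)"
    by (simp add: card_image inj_on_def)
  finally show ?thesis .
qed

lemma no_survivors_in_low_degree:
  assumes "filtered_complex C" "barcode_basis C B"
  shows "\<exists>i0. \<forall>i\<le>i0. survivors C B i q p = {}"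
proof -
  interpret FC: filtered_complex C by fact
  interpret C: barcode_basis C B by fact
  obtain d where d: "\<And>b. b \<in> B \<Longrightarrow> b \<in> grd C (d b)" using C.basis_homogeneous by metis
  have "survivors C B i q p = {}" if i: "i \<le> Min (insert 0 (d ` B)) - 1" for i
  proof (rule ccontr)
    assume "survivors C B i q p \<noteq> {}"
    then obtain b where b: "b \<in> B" "b \<in> grd C i" by (auto simp: survivors_def)
    then have "i = d b" using FC.degree_unique d C.basis_nonzero by blast
    moreover have "Min (insert 0 (d ` B)) \<le> d b" using b(1) C.finite_basis by (intro Min_le) auto
    ultimately show False using i by simp
  qed
  then show ?thesis by blast
qed

section \<open>Cancellation\<close>

text \<open>Multiplication of a Laurent polynomial by \<open>1 + t\<^sup>s\<close> is injective. For \<open>s = 1\<close> the coefficients are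
  compared one after another, starting in a degree below which both vanish.\<close>

lemma shift_sum_cancel:
  fixes m n :: "int \<Rightarrow> nat"
  assumes s: "s = 0 \<or> s = 1"
    and eq: "\<And>i. m (i - s) + m i = n (i - s) + n i"
    and low: "\<And>i. i \<le> i0 \<Longrightarrow> m i = 0" "\<And>i. i \<le> i0 \<Longrightarrow> n i = 0"
  shows "m i = n i"
proof (cases "s = 0 \<or> i \<le> i0")
  case True
  then show ?thesis using eq[of i] low[of i] by auto
next
  case False
  then have "i0 \<le> i" "s = 1" using s by auto
  then show ?thesis
  proof (induction i rule: int_ge_induct)
    case base
    then show ?case using low by simp
  next
    case (step i)
    then show ?case using eq[of "i + 1"] by simp
  qed
qed

theorem proposition1p0p2:
  fixes C1 :: "('k::field, 'a::ab_group_add) filt_complex"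
    and C2 :: "('k, 'b::ab_group_add) filt_complex"
    and X :: "('k, 'k \<times> 'k) filt_complex"
  assumes "filtered_complex C1" and "fin_dim C1"
    and "filtered_complex C2" and "fin_dim C2"
    and "X = H_S1 \<or> X = H_S0"
    and "filtered_homotopy_equivalent (tensor C1 X) (tensor C2 X)"
  shows "filtered_homotopy_equivalent C1 C2"
proof -
  note C1 = assms(1) and C2 = assms(3)
  obtain s where s: "s = 0 \<or> s = 1" and X: "X = plane s"
    using assms(5) H_S0_eq_plane H_S1_eq_plane by blast
  obtain B1 where B1: "barcode_basis C1 B1"
    using filtered_complex.ex_barcode_basis[OF C1 assms(2)] by blast
  obtain B2 where B2: "barcode_basis C2 B2"
    using filtered_complex.ex_barcode_basis[OF C2 assms(4)] by blast
  obtain \<phi>1 \<psi>1 where T1: "filtered_isomorphism (shift_sum s C1) (tensor C1 X) \<phi>1 \<psi>1"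
    "exhaustive (tensor C1 X)" unfolding X by (rule tensor_plane[OF C1])
  obtain \<phi>2 \<psi>2 where T2: "filtered_isomorphism (shift_sum s C2) (tensor C2 X) \<phi>2 \<psi>2"
    "exhaustive (tensor C2 X)" unfolding X by (rule tensor_plane[OF C2])
  have eqv: "filtered_homotopy_equivalent (shift_sum s C1) (shift_sum s C2)"
    by (rule homotopy_equivalent_transport[OF exhaustive_shift_sum[OF C1] T1(2)
          exhaustive_shift_sum[OF C2] T2(2) T1(1) T2(1) assms(6)])
  then have eqv': "filtered_homotopy_equivalent (shift_sum s C2) (shift_sum s C1)"
    unfolding filtered_homotopy_equivalent_def by blast
  note D1 = barcode_basis_shift_sum[OF C1 B1, of s] and D2 = barcode_basis_shift_sum[OF C2 B2, of s]
  have "card (survivors C1 B1 i q p) = card (survivors C2 B2 i q p)" if qp: "q \<le> p" for i q p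
  proof -
    obtain i1 where i1: "\<forall>i\<le>i1. survivors C1 B1 i q p = {}"
      using no_survivors_in_low_degree[OF C1 B1] by blast
    obtain i2 where i2: "\<forall>i\<le>i2. survivors C2 B2 i q p = {}"
      using no_survivors_in_low_degree[OF C2 B2] by blast
    have "card (survivors C1 B1 (j - s) q p) + card (survivors C1 B1 j q p)
        = card (survivors C2 B2 (j - s) q p) + card (survivors C2 B2 j q p)" for j
      using survivors_card_le[OF D1 D2 eqv qp, of j] survivors_card_le[OF D2 D1 eqv' qp, of j]
      unfolding card_survivors_shift_sum[OF C1 B1] card_survivors_shift_sum[OF C2 B2] by simp
    then show ?thesis
      by (rule shift_sum_cancel[OF s, where ?i0.0 = "min i1 i2"]) (use i1 i2 in auto)
  qed
  then show ?thesis by (rule homotopy_equivalent_if_same_survivors[OF C1 B1 C2 B2])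
qed

end
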